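(* Let $R=K[x_1,\ldots,x_n]$ be a polynomial ring over a field $K$, let $I\subset R$ be a monomial ideal without embedded primes and let $\mathfrak{I}_1,\ldots,\mathfrak{I}_r$ be its primary components. If $R[\mathfrak{I}_it]$ is normal for all $i$, then $I^k=I^{(k)}$ for all $k\geq 1$ if and only if $\mathrm{Cn}(I)=\mathbb{R}_+(I)$ and $R[It]$ is normal.
   Context: Let $t$ be a new variable. The Rees algebra of an ideal $J\subset R$ is $R[Jt]=R\oplus Jt\oplus\cdots\oplus J^kt^k\oplus\cdots\subset R[t]$. The $k$-th symbolic power of $I$ is $I^{(k)}=\bigcap_i(I^kR_{\mathfrak{p}_i}\cap R)$, the intersection being over the minimal primes $\mathfrak{p}_i$ of $I$. A domain is normal if it is integrally closed in its field of fractions. The primary components of $I$ are the ideals in its minimal irredundant primary decomposition $I=\bigcap_{i=1}^r\mathfrak{I}_i$. For a monomial ideal $J$ with minimal set of monomial generators $\{x^{v_1},\ldots,x^{v_m}\}$, $\mathbb{R}_+(J)\subset\mathbb{R}^{n+1}$ denotes the cone generated by $\{e_1,\ldots,e_n,(v_1,1),\ldots,(v_m,1)\}$, where $e_i$ is the $i$-th unit vector of $\mathbb{Z}^{n+1}$. The Simis cone of $I$ is the rational polyhedral cone $\mathrm{Cn}(I)=\bigcap_{i=1}^r\mathbb{R}_+(\mathfrak{I}_i)$. *)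

theory Defs
  imports
    "HOL-Analysis.Analysis"
    "HOL-Library.Poly_Mapping"
    "HOL-Computational_Algebra.Fraction_Field"
    "HOL-Computational_Algebra.Polynomial"
begin

section \<open>Ideals of a commutative ring\<close>

text \<open>
  A commutative ring is a module over itself, and its ideals are the submodules. The library
  notions are used through the unqualified locale constants because a global interpretation of
  \<^locale>\<open>module\<close> would add \<open>a * (b * x) = a * b * x\<close> to the simpset.
\<close>

lemma module_mult: "module ((*) :: 'a::comm_ring_1 \<Rightarrow> 'a \<Rightarrow> 'a)"
  by unfold_locales (simp_all add: algebra_simps)

abbreviation is_ideal :: "'a::comm_ring_1 set \<Rightarrow> bool" where
  "is_ideal \<equiv> module.subspace (*)"

abbreviation ideal_gen :: "'a::comm_ring_1 set \<Rightarrow> 'a set" where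
  "ideal_gen \<equiv> module.span (*)"

definition prime_ideal :: "'a::comm_ring_1 set \<Rightarrow> bool" where
  "prime_ideal P \<longleftrightarrow> is_ideal P \<and> P \<noteq> UNIV \<and> (\<forall>a b. a * b \<in> P \<longrightarrow> a \<in> P \<or> b \<in> P)"

definition primary_ideal :: "'a::comm_ring_1 set \<Rightarrow> bool" where
  "primary_ideal Q \<longleftrightarrow> is_ideal Q \<and> Q \<noteq> UNIV \<and>
     (\<forall>a b. a * b \<in> Q \<longrightarrow> a \<in> Q \<or> (\<exists>m\<ge>1. b ^ m \<in> Q))"

definition radical_ideal :: "'a::comm_ring_1 set \<Rightarrow> 'a set" where
  "radical_ideal J = {a. \<exists>m\<ge>1. a ^ m \<in> J}"

primrec ideal_power :: "'a::comm_ring_1 set \<Rightarrow> nat \<Rightarrow> 'a set" where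
  "ideal_power J 0 = UNIV"
| "ideal_power J (Suc k) = ideal_gen {a * b | a b. a \<in> J \<and> b \<in> ideal_power J k}"

definition minimal_prime :: "'a::comm_ring_1 set \<Rightarrow> 'a set \<Rightarrow> bool" where
  "minimal_prime J P \<longleftrightarrow> prime_ideal P \<and> J \<subseteq> P \<and>
     (\<forall>P'. prime_ideal P' \<and> J \<subseteq> P' \<and> P' \<subseteq> P \<longrightarrow> P' = P)"

definition associated_prime :: "'a::comm_ring_1 set \<Rightarrow> 'a set \<Rightarrow> bool" where
  "associated_prime J P \<longleftrightarrow> prime_ideal P \<and> (\<exists>f. P = {a. a * f \<in> J})"

definition embedded_prime :: "'a::comm_ring_1 set \<Rightarrow> 'a set \<Rightarrow> bool" where
  "embedded_prime J P \<longleftrightarrow> associated_prime J P \<and> \<not> minimal_prime J P"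

text \<open>
  Irredundancy means that no component can be omitted, minimality that the radicals of the components
  are pairwise distinct.
\<close>

definition minimal_primary_decomposition :: "'a::comm_ring_1 set \<Rightarrow> 'a set set \<Rightarrow> bool" where
  "minimal_primary_decomposition J C \<longleftrightarrow>
     finite C \<and> (\<forall>Q\<in>C. primary_ideal Q) \<and> \<Inter>C = J \<and>
     (\<forall>Q\<in>C. \<Inter>(C - {Q}) \<noteq> J) \<and> inj_on radical_ideal C"


section \<open>Localisation and symbolic powers\<close>

abbreviation fract_of :: "'a::idom \<Rightarrow> 'a fract" where
  "fract_of a \<equiv> Fract a 1"

definition localisation :: "'a::idom set \<Rightarrow> 'a fract set" where
  "localisation P = {Fract a s | a s. s \<notin> P}"

text \<open>\<open>extension_ideal A J\<close> is the ideal \<open>J A\<close> generated by \<open>J\<close> in an overring \<open>A\<close> of the ring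
  inside its field of fractions.\<close>

definition extension_ideal :: "'a::idom fract set \<Rightarrow> 'a set \<Rightarrow> 'a fract set" where
  "extension_ideal A J =
     {(\<Sum>x\<in>X. c x * fract_of x) | X c. finite X \<and> X \<subseteq> J \<and> (\<forall>x\<in>X. c x \<in> A)}"

definition symbolic_power :: "'a::idom set \<Rightarrow> nat \<Rightarrow> 'a set" where
  "symbolic_power J k =
     (\<Inter>P \<in> {P. minimal_prime J P}.
        {f. fract_of f \<in> extension_ideal (localisation P) (ideal_power J k)})"


section \<open>Normal domains and Rees algebras\<close>

definition fraction_field_of :: "'a::idom set \<Rightarrow> 'a fract set" where
  "fraction_field_of A = {Fract a b | a b. a \<in> A \<and> b \<in> A \<and> b \<noteq> 0}"

definition integral_over :: "'a::comm_ring_1 set \<Rightarrow> 'a \<Rightarrow> bool" where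
  "integral_over A z \<longleftrightarrow> (\<exists>p. lead_coeff p = 1 \<and> (\<forall>i. coeff p i \<in> A) \<and> poly p z = 0)"

text \<open>The field of fractions of a subring \<open>A\<close> is taken inside that of the ambient domain.\<close>

definition normal_subring :: "'a::idom set \<Rightarrow> bool" where
  "normal_subring A \<longleftrightarrow>
     (\<forall>z \<in> fraction_field_of A. integral_over (fract_of ` A) z \<longrightarrow> z \<in> fract_of ` A)"

definition rees_algebra :: "'a::comm_ring_1 set \<Rightarrow> 'a poly set" where
  "rees_algebra J = {p. \<forall>k. coeff p k \<in> ideal_power J k}"


section \<open>Monomial ideals and their cones\<close>

text \<open>
  \<open>('n, 'k) mpoly\<close> is the polynomial ring over \<open>'k\<close> in the variables indexed by \<open>'n\<close>. A linear
  order on \<open>'n\<close> is needed for the library's proof that this ring is an integral domain.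
\<close>

type_synonym ('n, 'k) mpoly = "('n \<Rightarrow>\<^sub>0 nat) \<Rightarrow>\<^sub>0 'k"

definition monom_of :: "('n \<Rightarrow>\<^sub>0 nat) \<Rightarrow> ('n, 'k::comm_ring_1) mpoly" where
  "monom_of v = Poly_Mapping.single v 1"

definition monomial_ideal :: "('n, 'k::comm_ring_1) mpoly set \<Rightarrow> bool" where
  "monomial_ideal J \<longleftrightarrow> (\<exists>G. J = ideal_gen (monom_of ` G))"

text \<open>For a monomial ideal, the inclusion-minimal set of monomial generators exists and is unique (it
  consists of the monomials in \<open>J\<close> that are minimal under divisibility); only its exponents are kept.\<close>

definition min_generators :: "('n, 'k::comm_ring_1) mpoly set \<Rightarrow> ('n \<Rightarrow>\<^sub>0 nat) set" where
  "min_generators J =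
     (THE G. J = ideal_gen (monom_of ` G) \<and> (\<forall>H. H \<subset> G \<longrightarrow> J \<noteq> ideal_gen (monom_of ` H)))"

definition exponent_vec :: "('n \<Rightarrow>\<^sub>0 nat) \<Rightarrow> real ^ 'n::finite" where
  "exponent_vec v = (\<chi> i. real (Poly_Mapping.lookup v i))"

definition rees_cone :: "('n::finite, 'k::comm_ring_1) mpoly set \<Rightarrow> ((real ^ 'n) \<times> real) set" where
  "rees_cone J = convex_cone hull
     (range (\<lambda>i. (axis i 1, 0)) \<union> (\<lambda>v. (exponent_vec v, 1)) ` min_generators J)"

text \<open>The argument is the set of primary components of the ideal, not the ideal itself.\<close>

definition simis_cone :: "('n::finite, 'k::comm_ring_1) mpoly set set \<Rightarrow> ((real ^ 'n) \<times> real) set" where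
  "simis_cone C = (\<Inter>Q\<in>C. rees_cone Q)"

end

theory Submission
  imports Defs
begin

text \<open>
A monomial ideal is determined by the set \<open>E\<close> of exponents of its monomials, its \<open>k\<close>-th power by
the set \<open>E\<^sub>k\<close> of sums of \<open>k\<close> elements of \<open>E\<close>, and a polynomial lies in such an ideal when all its
exponents lie in the set. Both sides of the equivalence thereby become statements about lattice points
\<open>(a, k)\<close>. Three facts carry the proof.

\<^item> Without embedded primes, the primary components are again monomial ideals and
  \<open>I\<^sup>(\<^sup>k\<^sup>) = (\<Inter>Q. Q\<^sup>k)\<close> (\<open>symbolic_power_eq_Inter\<close>). Every radical of a component \<open>Q\<close> is an
  associated prime, hence a minimal prime \<open>P\<close>, and a minimal prime of a monomial ideal is generated
  by variables. Each of the other radicals therefore contains a variable outside \<open>P\<close>, a product of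
  powers of such variables is a monomial \<open>s \<notin> P\<close> with \<open>Q = (I : s)\<close>, and so \<open>Q\<close> is monomial and
  \<open>I\<^sup>k\<close> and \<open>Q\<^sup>k\<close> agree after localising at \<open>P\<close>. Finally, membership in \<open>Q\<^sup>k\<close> only depends on the
  exponents of the variables in \<open>P\<close>, which makes \<open>Q\<^sup>k\<close> saturated with respect to \<open>P\<close>.

\<^item> A monomial \<open>x\<^sup>a\<close> in \<open>J\<^sup>k\<close> has \<open>(a, k) \<in> \<real>\<^sub>+(J)\<close>; the converse holds if \<open>R[Jt]\<close> is normal
  (\<open>power_mem_exponent_cone\<close>, \<open>normal_rees_algebra_contains_lattice_points\<close>), because a
  lattice point of the cone has a positive multiple that is a sum of generators with natural
  coefficients, which makes \<open>x\<^sup>at\<^sup>k\<close> integral over \<open>R[Jt]\<close>.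

\<^item> The cones \<open>\<real>\<^sub>+(J)\<close> are closed and closed under increasing the coordinates of \<open>a\<close>, so an inclusion
  between intersections of such cones can be tested on lattice points
  (\<open>exponent_cone_lattice_criterion\<close>): round the coordinates up to rational numbers.

If \<open>I\<^sup>k = I\<^sup>(\<^sup>k\<^sup>)\<close> for all \<open>k\<close>, then \<open>R[It]\<close> is the intersection of the normal rings \<open>R[Qt]\<close>,
hence normal, and a lattice point \<open>(a, k)\<close> of the Simis cone satisfies \<open>x\<^sup>a \<in> (\<Inter>Q. Q\<^sup>k) = I\<^sup>k\<close>, so it lies in
\<open>\<real>\<^sub>+(I)\<close>. Conversely, an exponent \<open>a\<close> of an element of \<open>I\<^sup>(\<^sup>k\<^sup>) = (\<Inter>Q. Q\<^sup>k)\<close> gives a point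
\<open>(a, k)\<close> of the Simis cone; if that cone is \<open>\<real>\<^sub>+(I)\<close> and \<open>R[It]\<close> is normal, then \<open>x\<^sup>a \<in> I\<^sup>k\<close>.
\<close>

section \<open>Primary decompositions and symbolic powers\<close>

lemmas ideal_zero = module.subspace_0 [OF module_mult]
lemmas ideal_add = module.subspace_add [OF module_mult]
lemmas ideal_mult_left = module.subspace_scale [OF module_mult]
lemmas ideal_diff = module.subspace_diff [OF module_mult]
lemmas ideal_gen_superset = module.span_base [OF module_mult]
lemmas ideal_gen_least = module.span_minimal [OF module_mult]
lemmas is_ideal_gen = module.subspace_span [OF module_mult]
lemmas is_idealI = module.subspaceI [OF module_mult]

lemma ideal_mult_right: "is_ideal J \<Longrightarrow> x \<in> J \<Longrightarrow> x * c \<in> J"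
  using ideal_mult_left[of J x c] by (simp add: mult.commute)

lemma prime_ideal_ideal: "prime_ideal P \<Longrightarrow> is_ideal P"
  by (simp add: prime_ideal_def)

lemma primary_ideal_ideal: "primary_ideal Q \<Longrightarrow> is_ideal Q"
  by (simp add: primary_ideal_def)

lemma ideal_one_iff: "is_ideal J \<Longrightarrow> 1 \<in> J \<longleftrightarrow> J = UNIV"
  using ideal_mult_left[of J 1] by auto

lemma prime_ideal_one: "prime_ideal P \<Longrightarrow> 1 \<notin> P"
  by (simp add: prime_ideal_def ideal_one_iff)

lemma prime_ideal_mult_notin: "prime_ideal P \<Longrightarrow> a \<notin> P \<Longrightarrow> b \<notin> P \<Longrightarrow> a * b \<notin> P"
  by (auto simp: prime_ideal_def)

lemma prime_ideal_power_notin: "prime_ideal P \<Longrightarrow> a \<notin> P \<Longrightarrow> a ^ m \<notin> P"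
  by (induction m) (auto simp: prime_ideal_one prime_ideal_mult_notin)

lemma prime_ideal_prod_notin:
  "prime_ideal P \<Longrightarrow> (\<And>i. i \<in> A \<Longrightarrow> f i \<notin> P) \<Longrightarrow> (\<Prod>i\<in>A. f i) \<notin> P"
  by (induction A rule: infinite_finite_induct) (auto simp: prime_ideal_one prime_ideal_mult_notin)

lemma is_ideal_power: "is_ideal (ideal_power J k)"
  by (cases k) (simp_all add: is_ideal_gen module.subspace_UNIV[OF module_mult])

lemma ideal_power_mono: "J \<subseteq> J' \<Longrightarrow> ideal_power J k \<subseteq> ideal_power J' k"
proof (induction k)
  case (Suc k)
  then show ?case
    by (auto intro!: module.span_mono[OF module_mult])
qed simp

lemma primary_idealD: "primary_ideal Q \<Longrightarrow> a * b \<in> Q \<Longrightarrow> b \<notin> radical_ideal Q \<Longrightarrow> a \<in> Q"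
  by (auto simp: primary_ideal_def radical_ideal_def)

lemma mult_mem_radical_imp_mem:
  assumes Q: "primary_ideal Q" and ab: "a * b \<in> radical_ideal Q" and b: "b \<notin> radical_ideal Q"
  shows "a \<in> radical_ideal Q"
proof -
  obtain m where m: "m \<ge> 1" "a ^ m * b ^ m \<in> Q"
    using ab by (auto simp: radical_ideal_def power_mult_distrib)
  have "b ^ m \<notin> radical_ideal Q"
  proof
    assume "b ^ m \<in> radical_ideal Q"
    then obtain l where "l \<ge> 1" "b ^ (m * l) \<in> Q" by (auto simp: radical_ideal_def power_mult)
    moreover have "m * l \<ge> 1" using m(1) \<open>l \<ge> 1\<close> by simp
    ultimately show False using b by (auto simp: radical_ideal_def)
  qed
  with Q m have "a ^ m \<in> Q" by (blast intro: primary_idealD)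
  with m(1) show ?thesis by (auto simp: radical_ideal_def)
qed

text \<open>
In the application the radical is recognised as a colon ideal, which makes it an ideal.
\<close>

lemma prime_ideal_radical:
  assumes Q: "primary_ideal Q" and ideal: "is_ideal (radical_ideal Q)"
  shows "prime_ideal (radical_ideal Q)"
  unfolding prime_ideal_def
proof (intro conjI allI impI)
  have "1 \<notin> radical_ideal Q"
    using Q by (auto simp: radical_ideal_def primary_ideal_def ideal_one_iff)
  then show "radical_ideal Q \<noteq> UNIV" by auto
qed (use ideal mult_mem_radical_imp_mem[OF Q] in auto)

text \<open>
Let \<open>R\<close> be the intersection of the components other than \<open>Q\<close>. For \<open>f \<in> R - Q\<close> the colon ideal \<open>(J : f)\<close>
equals \<open>(Q : f)\<close>, which is contained in the radical of \<open>Q\<close>. By the chain condition, choose \<open>f\<close> with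
\<open>(J : f)\<close> maximal. An element \<open>y\<close> of the radical with \<open>y f \<notin> J\<close> could not enlarge this colon ideal, so
neither could any power of \<open>y\<close>; but some power of \<open>y\<close> lies in \<open>Q\<close>.
\<close>

lemma primary_component_radical_associated:
  fixes J :: "'a::comm_ring_1 set"
  assumes acc: "wf {(B, A :: 'a set). is_ideal A \<and> is_ideal B \<and> A \<subset> B}"
    and C: "minimal_primary_decomposition J C" and Q: "Q \<in> C"
  shows "associated_prime J (radical_ideal Q)"
proof -
  define R where "R = \<Inter>(C - {Q})"
  have primary: "primary_ideal Q'" if "Q' \<in> C" for Q'
    using C that by (simp add: minimal_primary_decomposition_def)
  have J: "J = Q \<inter> R"
    using C Q by (auto simp: minimal_primary_decomposition_def R_def)
  have "R \<noteq> J"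
    using C Q by (simp add: minimal_primary_decomposition_def R_def)
  then obtain g where g: "g \<in> R - Q" using J by auto
  have R: "is_ideal R"
    unfolding R_def by (rule module.subspace_Inter[OF module_mult]) (auto dest: primary primary_ideal_ideal)
  have idJ: "is_ideal J"
    unfolding J using R primary[OF Q] primary_ideal_ideal module.subspace_inter[OF module_mult] by blast
  define colon where "colon h = {a. a * h \<in> J}" for h
  have colon: "is_ideal (colon h)" for h
    unfolding colon_def
    by (rule is_idealI) (auto simp: algebra_simps ideal_zero[OF idJ] intro: ideal_add[OF idJ] ideal_mult_left[OF idJ])
  have "colon g \<in> colon ` (R - Q)" using g by blast
  with acc obtain M where M: "M \<in> colon ` (R - Q)"
    "\<And>B. (B, M) \<in> {(B, A). is_ideal A \<and> is_ideal B \<and> A \<subset> B} \<Longrightarrow> B \<notin> colon ` (R - Q)"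
    by (rule wfE_min) (rule that, assumption, blast)
  from M(1) obtain f where f: "f \<in> R" "f \<notin> Q" "M = colon f" by blast
  have max: "colon h = colon f" if "h \<in> R - Q" "colon f \<subseteq> colon h" for h
  proof -
    have "colon h \<in> colon ` (R - Q)" using that(1) by blast
    then have "\<not> colon f \<subset> colon h"
      using M(2)[of "colon h"] colon[of f] colon[of h] f(3) by blast
    with that(2) show ?thesis by blast
  qed
  have "colon f = radical_ideal Q"
  proof (intro equalityI subsetI)
    fix a assume "a \<in> colon f"
    then show "a \<in> radical_ideal Q"
      using primary_idealD[OF primary[OF Q], of f a] f(2) J by (auto simp: colon_def mult.commute)
  next
    fix y assume y: "y \<in> radical_ideal Q"
    then obtain m where m: "y ^ m \<in> Q" by (auto simp: radical_ideal_def)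
    show "y \<in> colon f"
    proof (rule ccontr)
      assume "y \<notin> colon f"
      \<comment> \<open>multiplying by \<open>y\<close> neither leaves \<open>R - Q\<close> nor enlarges the colon ideal\<close>
      have stable: "y ^ i * f \<in> R - Q \<and> colon (y ^ i * f) = colon f" for i
      proof (induction i)
        case (Suc i)
        have "y \<notin> colon (y ^ i * f)" using Suc \<open>y \<notin> colon f\<close> by simp
        then have "y ^ Suc i * f \<notin> Q \<inter> R" unfolding colon_def J by (simp add: mult.assoc)
        moreover have "y ^ Suc i * f \<in> R" using ideal_mult_left[OF R f(1)] by blast
        ultimately have "y ^ Suc i * f \<in> R - Q" by blast
        moreover have "colon f \<subseteq> colon (y ^ Suc i * f)"
        proof
          fix a assume "a \<in> colon f"
          then have "y ^ Suc i * (a * f) \<in> J" unfolding colon_def by (auto intro: ideal_mult_left[OF idJ] simp del: power_Suc)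
          then show "a \<in> colon (y ^ Suc i * f)" unfolding colon_def by (simp add: mult.left_commute)
        qed
        ultimately show ?case using max by blast
      qed (use f in auto)
      have "y ^ m * f \<in> Q"
        using m ideal_mult_right[OF primary_ideal_ideal[OF primary[OF Q]]] by blast
      with stable[of m] show False by blast
    qed
  qed
  moreover have "prime_ideal (radical_ideal Q)"
    using prime_ideal_radical[OF primary[OF Q]] colon[of f] calculation by simp
  ultimately show ?thesis
    unfolding associated_prime_def colon_def by blast
qed

text \<open>
A prime over a finite intersection contains one of the components, hence its radical.
\<close>

lemma minimal_primes_eq_radicals:
  assumes C: "minimal_primary_decomposition J C"
    and min: "\<And>Q. Q \<in> C \<Longrightarrow> minimal_prime J (radical_ideal Q)"
  shows "minimal_prime J P \<longleftrightarrow> P \<in> radical_ideal ` C"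
proof
  assume P: "minimal_prime J P"
  then have prime: "prime_ideal P" and JP: "J \<subseteq> P" by (auto simp: minimal_prime_def)
  have fin: "finite C" and J: "\<Inter>C = J" using C by (auto simp: minimal_primary_decomposition_def)
  have "\<exists>Q\<in>C. Q \<subseteq> P"
  proof (rule ccontr)
    assume "\<not> ?thesis"
    then have "\<forall>Q\<in>C. \<exists>s. s \<in> Q - P" by blast
    then obtain s where s: "\<And>Q. Q \<in> C \<Longrightarrow> s Q \<in> Q - P" by metis
    have "(\<Prod>Q\<in>C. s Q) \<in> Q" if "Q \<in> C" for Q
    proof -
      have "is_ideal Q" using C that by (auto simp: minimal_primary_decomposition_def primary_ideal_ideal)
      then show ?thesis using s[OF that] prod.remove[OF fin that, of s] ideal_mult_right by fastforce
    qed
    then have "(\<Prod>Q\<in>C. s Q) \<in> P" using J JP by blast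
    moreover have "(\<Prod>Q\<in>C. s Q) \<notin> P" using s by (intro prime_ideal_prod_notin[OF prime]) auto
    ultimately show False by blast
  qed
  then obtain Q where Q: "Q \<in> C" "Q \<subseteq> P" by blast
  have "radical_ideal Q \<subseteq> P"
    using Q(2) prime_ideal_power_notin[OF prime] by (auto simp: radical_ideal_def)
  with min[OF Q(1)] P have "P = radical_ideal Q"
    by (auto simp: minimal_prime_def)
  with Q show "P \<in> radical_ideal ` C" by blast
qed (use min in auto)

text \<open>
Clearing the denominators of a linear combination over the local ring needs only one common denominator,
and the complement of a prime is closed under products.
\<close>

lemma fract_of_mem_extension_iff:
  fixes J :: "'a::idom set"
  assumes P: "prime_ideal P" and J: "is_ideal J"
  shows "fract_of f \<in> extension_ideal (localisation P) J \<longleftrightarrow> (\<exists>s. s \<notin> P \<and> s * f \<in> J)"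
proof
  have nz: "s \<noteq> 0" if "s \<notin> P" for s
    using that ideal_zero[OF prime_ideal_ideal[OF P]] by blast
  {
    assume "fract_of f \<in> extension_ideal (localisation P) J"
    then obtain X c where X: "finite X" "X \<subseteq> J" "\<And>x. x \<in> X \<Longrightarrow> c x \<in> localisation P"
      and f: "fract_of f = (\<Sum>x\<in>X. c x * fract_of x)"
      unfolding extension_ideal_def by blast
    have "\<exists>s j. s \<notin> P \<and> j \<in> J \<and> (\<Sum>x\<in>X. c x * fract_of x) = Fract j s"
      using X
    proof (induction X rule: finite_induct)
      case empty
      then show ?case
        using prime_ideal_one[OF P] ideal_zero[OF J] Zero_fract_def[where 'a='a] by force
    next
      case (insert x X)
      then obtain s j where sj: "s \<notin> P" "j \<in> J" "(\<Sum>x\<in>X. c x * fract_of x) = Fract j s" by auto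
      have "c x \<in> localisation P" using insert by auto
      then obtain a t where at: "c x = Fract a t" "t \<notin> P" by (auto simp: localisation_def)
      have "(\<Sum>x\<in>insert x X. c x * fract_of x) = Fract (a * x * s + j * t) (t * s)"
        using insert sj at nz by simp
      moreover have "a * x * s + j * t \<in> J"
        using insert.prems sj(2) J by (auto intro!: ideal_add[OF J] intro: ideal_mult_left ideal_mult_right)
      ultimately show ?case using prime_ideal_mult_notin[OF P at(2) sj(1)] by metis
    qed
    then obtain s j where sj: "s \<notin> P" "j \<in> J" "fract_of f = Fract j s" using f by metis
    then have "s * f = j" using nz by (simp add: eq_fract mult.commute)
    with sj show "\<exists>s. s \<notin> P \<and> s * f \<in> J" by blast
  next
    assume "\<exists>s. s \<notin> P \<and> s * f \<in> J"
    then obtain s where s: "s \<notin> P" "s * f \<in> J" by blast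
    have "fract_of f = Fract 1 s * fract_of (s * f)"
      using nz[OF s(1)] by (simp add: eq_fract)
    then have "fract_of f = (\<Sum>x\<in>{s * f}. Fract 1 s * fract_of x)" by simp
    moreover have "Fract 1 s \<in> localisation P" using s by (auto simp: localisation_def)
    ultimately show "fract_of f \<in> extension_ideal (localisation P) J"
      unfolding extension_ideal_def using s(2)
      by (intro CollectI exI[of _ "{s * f}"] exI[of _ "\<lambda>_. Fract 1 s"]) simp
  }
qed

lemma symbolic_power_iff:
  fixes J :: "'a::idom set"
  shows "f \<in> symbolic_power J k \<longleftrightarrow>
    (\<forall>P. minimal_prime J P \<longrightarrow> (\<exists>s. s \<notin> P \<and> s * f \<in> ideal_power J k))"
proof -
  have "fract_of f \<in> extension_ideal (localisation P) (ideal_power J k) \<longleftrightarrow>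
      (\<exists>s. s \<notin> P \<and> s * f \<in> ideal_power J k)" if "minimal_prime J P" for P
    using that is_ideal_power by (intro fract_of_mem_extension_iff) (auto simp: minimal_prime_def)
  then show ?thesis by (auto simp: symbolic_power_def)
qed

section \<open>Dickson's lemma and the order of exponents\<close>

text \<open>
A decreasing sequence of natural numbers is constant from the index of its least value on.
\<close>

lemma exists_incseq_subseq:
  fixes f :: "nat \<Rightarrow> nat"
  shows "\<exists>g. strict_mono g \<and> incseq (f \<circ> g)"
proof -
  obtain g where g: "strict_mono g" "monoseq (\<lambda>n. f (g n))" using seq_monosub by blast
  show ?thesis
  proof (cases "incseq (\<lambda>n. f (g n))")
    case True
    then show ?thesis using g by (auto simp: o_def)
  next
    case False
    then have dec: "decseq (\<lambda>n. f (g n))" using g(2) by (simp add: monoseq_iff)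
    obtain N where N: "\<And>n. f (g N) \<le> f (g n)"
      using ex_has_least_nat[of "\<lambda>_. True" 0 "\<lambda>n. f (g n)"] by blast
    have "f (g (N + n)) = f (g N)" for n
      using N[of "N + n"] decseqD[OF dec, of N "N + n"] by simp
    then have "incseq (f \<circ> (\<lambda>n. g (N + n)))" by (simp add: incseq_def)
    moreover have "strict_mono (\<lambda>n. g (N + n))" using g(1) by (simp add: strict_mono_def)
    ultimately show ?thesis by blast
  qed
qed

text \<open>
Dickson's lemma: passing to an increasing subsequence for one coordinate after the other, all coordinates
become increasing simultaneously.
\<close>

lemma dickson:
  fixes a :: "nat \<Rightarrow> 'n::finite \<Rightarrow> nat"
  shows "\<exists>i j. i < j \<and> a i \<le> a j"
proof -
  have "finite S \<Longrightarrow> \<exists>g. strict_mono g \<and> (\<forall>s\<in>S. incseq (\<lambda>n. a (g n) s))" for S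
  proof (induction S rule: finite_induct)
    case empty
    show ?case by (auto intro: exI[of _ id] strict_mono_id)
  next
    case (insert s S)
    then obtain g where g: "strict_mono g" "\<forall>s\<in>S. incseq (\<lambda>n. a (g n) s)" by blast
    obtain h where h: "strict_mono h" "incseq (\<lambda>n. a (g (h n)) s)"
      using exists_incseq_subseq[of "\<lambda>n. a (g n) s"] by (auto simp: o_def)
    have "incseq (\<lambda>n. a (g (h n)) t)" if "t \<in> S" for t
      using g(2) that strict_mono_mono[OF h(1)] by (auto simp: incseq_def dest: monoD)
    moreover have "strict_mono (\<lambda>n. g (h n))" using g(1) h(1) by (simp add: strict_mono_def)
    ultimately show ?case using h(2) by (intro exI[of _ "\<lambda>n. g (h n)"]) auto
  qed
  from this[of UNIV] obtain g where g: "strict_mono g" "\<And>s. incseq (\<lambda>n. a (g n) s)" by auto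
  have "a (g 0) \<le> a (g 1)" using g(2) by (auto simp: le_fun_def incseq_def)
  moreover have "g 0 < g 1" using g(1) by (simp add: strict_mono_def)
  ultimately show ?thesis by blast
qed

text \<open>
The pointwise order of exponents is divisibility of monomials. It is written via \<open>lookup\<close> because the order
of the type \<open>_ \<Rightarrow>\<^sub>0 nat\<close> is lexicographic.
\<close>

lemma lookup_le_iff_add:
  fixes v a :: "'n::finite \<Rightarrow>\<^sub>0 nat"
  shows "Poly_Mapping.lookup v \<le> Poly_Mapping.lookup a \<longleftrightarrow> (\<exists>c. a = v + c)"
proof
  assume le: "Poly_Mapping.lookup v \<le> Poly_Mapping.lookup a"
  have "a = v + (a - v)"
    by (rule poly_mapping_eqI) (use le in \<open>simp add: lookup_add lookup_minus le_fun_def\<close>)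
  then show "\<exists>c. a = v + c" ..
qed (auto simp: le_fun_def lookup_add)

lemma zero_le_exponent: "(0 :: 'n::linorder \<Rightarrow>\<^sub>0 nat) \<le> a"
proof -
  have "\<not> a < 0" by transfer (auto simp: less_fun_def)
  then show ?thesis by simp
qed

lemma exponent_le_add: "(a :: 'n::linorder \<Rightarrow>\<^sub>0 nat) \<le> a + c"
  using add_left_mono[OF zero_le_exponent, of a c] by simp

text \<open>
The lexicographic order extends divisibility, and by Dickson's lemma every sequence contains a pair that
increases for divisibility.
\<close>

lemma wf_exponents: "wf {(a, b). a < (b :: 'n::{finite,linorder} \<Rightarrow>\<^sub>0 nat)}"
  unfolding wf_iff_no_infinite_down_chain
proof
  assume "\<exists>f. \<forall>i. (f (Suc i), f i) \<in> {(a, b). a < (b :: 'n \<Rightarrow>\<^sub>0 nat)}"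
  then obtain f :: "nat \<Rightarrow> 'n \<Rightarrow>\<^sub>0 nat" where f: "\<And>i. f (Suc i) < f i" by auto
  obtain i j where ij: "i < j" "Poly_Mapping.lookup (f i) \<le> Poly_Mapping.lookup (f j)"
    using dickson[of "\<lambda>i. Poly_Mapping.lookup (f i)"] by blast
  have "f i \<le> f j" using ij(2) exponent_le_add by (auto simp: lookup_le_iff_add)
  moreover have "f (i + Suc k) < f i" for k
    by (induction k) (use f less_trans in auto)
  then have "f j < f i" using less_imp_Suc_add[OF ij(1)] by auto
  ultimately show False by simp
qed

section \<open>Products with monomials\<close>

text \<open>
When an exponent splits in only one way, no other terms of the factors can cancel the product of the two
corresponding terms.
\<close>

lemma lookup_mult_unique:
  fixes f g :: "('n::{finite,linorder}, 'k::comm_ring_1) mpoly"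
  assumes uniq: "\<And>u v. u \<in> Poly_Mapping.keys f \<Longrightarrow> v \<in> Poly_Mapping.keys g \<Longrightarrow> u + v = a + b \<Longrightarrow> u = a"
  shows "Poly_Mapping.lookup (f * g) (a + b) = Poly_Mapping.lookup f a * Poly_Mapping.lookup g b"
proof -
  have "Poly_Mapping.lookup f l * (\<Sum>q. Poly_Mapping.lookup g q when a + b = l + q)
      = (Poly_Mapping.lookup f a * Poly_Mapping.lookup g b when a = l)" for l
  proof (cases "a = l")
    case True
    then show ?thesis by simp
  next
    case False
    have "Poly_Mapping.lookup f l = 0 \<or> (\<forall>q. (Poly_Mapping.lookup g q when a + b = l + q) = 0)"
      using uniq[of l] False by (fastforce simp: in_keys_iff when_def)
    then show ?thesis using False by auto
  qed
  then show ?thesis by (simp add: lookup_mult)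
qed

lemma lookup_monom_mult:
  fixes f :: "('n::{finite,linorder}, 'k::field) mpoly"
  shows "Poly_Mapping.lookup (monom_of c * f) (c + a) = Poly_Mapping.lookup f a"
  using lookup_mult_unique[of "monom_of c" f c a] by (auto simp: monom_of_def)

lemma keys_monom_mult:
  fixes f :: "('n::{finite,linorder}, 'k::field) mpoly"
  shows "Poly_Mapping.keys (monom_of c * f) = (+) c ` Poly_Mapping.keys f"
proof
  show "Poly_Mapping.keys (monom_of c * f) \<subseteq> (+) c ` Poly_Mapping.keys f"
    using keys_mult[of "monom_of c" f] by (auto simp: monom_of_def)
qed (auto simp: in_keys_iff lookup_monom_mult)

lemma monom_of_add: "monom_of (a + b) = monom_of a * (monom_of b :: ('n, 'k::comm_ring_1) mpoly)"
  by (simp add: monom_of_def mult_single)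

lemma monom_of_0: "monom_of 0 = 1"
  by (simp add: monom_of_def)

lemma monom_of_sum: "monom_of (\<Sum>i\<in>A. g i) = (\<Prod>i\<in>A. monom_of (g i))"
  by (induction A rule: infinite_finite_induct) (auto simp: monom_of_0 monom_of_add)

lemma monom_of_single_power:
  "(monom_of (Poly_Mapping.single i 1)) ^ m = monom_of (Poly_Mapping.single i m)"
  by (induction m) (simp_all add: monom_of_0 flip: monom_of_add single_add)

lemma mpoly_eq_sum_terms:
  "f = (\<Sum>a\<in>Poly_Mapping.keys f. Poly_Mapping.single a (Poly_Mapping.lookup f a))"
proof (rule poly_mapping_eqI)
  fix k
  show "Poly_Mapping.lookup f k = Poly_Mapping.lookup
      (\<Sum>a\<in>Poly_Mapping.keys f. Poly_Mapping.single a (Poly_Mapping.lookup f a)) k"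
    by (auto simp: lookup_sum lookup_single when_def sum.If_cases in_keys_iff)
qed

section \<open>The ascending chain condition\<close>

definition leading_exponents :: "('n::{finite,linorder}, 'k::field) mpoly set \<Rightarrow> ('n \<Rightarrow>\<^sub>0 nat) set" where
  "leading_exponents J = {Max (Poly_Mapping.keys f) | f. f \<in> J \<and> f \<noteq> 0}"

text \<open>
Multiplication by a monomial translates the exponents, and translations preserve the order.
\<close>

lemma leading_exponents_add:
  assumes J: "is_ideal J" and a: "a \<in> leading_exponents J"
  shows "a + c \<in> leading_exponents J"
proof -
  obtain f where f: "f \<in> J" "f \<noteq> 0" "a = Max (Poly_Mapping.keys f)"
    using a by (auto simp: leading_exponents_def)
  have keys: "finite (Poly_Mapping.keys f)" "Poly_Mapping.keys f \<noteq> {}" using f(2) by auto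
  have "Max ((+) c ` Poly_Mapping.keys f) = c + Max (Poly_Mapping.keys f)"
    using keys by (intro mono_Max_commute[symmetric]) (auto intro: monoI add_left_mono)
  then have "Max (Poly_Mapping.keys (monom_of c * f)) = a + c"
    by (simp add: keys_monom_mult f(3) add.commute)
  moreover have "monom_of c * f \<noteq> 0" using keys keys_monom_mult[of c f] by (metis image_is_empty keys_zero)
  moreover have "monom_of c * f \<in> J" using f(1) J ideal_mult_left by blast
  ultimately show ?thesis unfolding leading_exponents_def by (metis (mono_tags, lifting) mem_Collect_eq)
qed

text \<open>
The division step of a Groebner basis argument: an element of \<open>J' - J\<close> of least leading exponent has the
leading exponent of some element of \<open>J\<close>, and subtracting a multiple of the latter makes it smaller.
\<close>

lemma eq_if_leading_exponents_subset:
  fixes J J' :: "('n::{finite,linorder}, 'k::field) mpoly set"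
  assumes J: "is_ideal J" and J': "is_ideal J'" and sub: "J \<subseteq> J'"
    and lead: "leading_exponents J' \<subseteq> leading_exponents J"
  shows "J' = J"
proof (rule ccontr)
  assume "J' \<noteq> J"
  then have "(\<lambda>f. Max (Poly_Mapping.keys f)) ` (J' - J) \<noteq> {}" using sub by blast
  then obtain a where a: "a \<in> (\<lambda>f. Max (Poly_Mapping.keys f)) ` (J' - J)"
    "\<And>b. (b, a) \<in> {(a, b). a < b} \<Longrightarrow> b \<notin> (\<lambda>f. Max (Poly_Mapping.keys f)) ` (J' - J)"
    using wf_exponents wf_eq_minimal[of "{(a, b). a < (b :: 'n \<Rightarrow>\<^sub>0 nat)}"] by (metis (no_types, lifting) ex_in_conv)
  then obtain f where f: "f \<in> J'" "f \<notin> J" "a = Max (Poly_Mapping.keys f)" by blast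
  have fnz: "f \<noteq> 0" using f(2) ideal_zero[OF J] by blast
  then have "a \<in> leading_exponents J" using f lead by (auto simp: leading_exponents_def)
  then obtain h where h: "h \<in> J" "h \<noteq> 0" "a = Max (Poly_Mapping.keys h)"
    by (auto simp: leading_exponents_def)
  have ah: "Poly_Mapping.lookup h a \<noteq> 0"
    using h Max_in[of "Poly_Mapping.keys h"] by (simp add: in_keys_iff)
  define c where "c = Poly_Mapping.lookup f a / Poly_Mapping.lookup h a"
  define g where "g = f - Poly_Mapping.single 0 c * h"
  have lookg: "Poly_Mapping.lookup g u = Poly_Mapping.lookup f u - c * Poly_Mapping.lookup h u" for u
  proof -
    have "Poly_Mapping.lookup (Poly_Mapping.single 0 c * h) (0 + u)
        = Poly_Mapping.lookup (Poly_Mapping.single (0 :: 'n \<Rightarrow>\<^sub>0 nat) c) 0 * Poly_Mapping.lookup h u"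
      by (rule lookup_mult_unique) (simp split: if_splits)
    then show ?thesis by (simp add: g_def lookup_minus)
  qed
  have cg: "Poly_Mapping.single 0 c * h \<in> J" by (rule ideal_mult_left[OF J h(1)])
  have "g \<in> J'" unfolding g_def using f(1) cg sub by (intro ideal_diff[OF J']) auto
  moreover have "g \<notin> J"
    using cg f(2) ideal_add[OF J, of g "Poly_Mapping.single 0 c * h"] by (auto simp: g_def)
  ultimately have g: "g \<in> J' - J" by blast
  then have gnz: "g \<noteq> 0" using ideal_zero[OF J] by blast
  define b where "b = Max (Poly_Mapping.keys g)"
  have bg: "b \<in> Poly_Mapping.keys g" unfolding b_def using gnz by (intro Max_in) auto
  then have "b \<in> Poly_Mapping.keys f \<or> b \<in> Poly_Mapping.keys h"
    using lookg[of b] by (auto simp: in_keys_iff)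
  then have "b \<le> a" using f(3) h(3) by (metis Max_ge finite_keys)
  moreover have "b \<noteq> a" using bg ah lookg[of a] by (auto simp: c_def in_keys_iff)
  ultimately have "b < a" by simp
  then show False using a(2)[of b] g b_def by blast
qed

text \<open>
The polynomial ring is Noetherian: along a strictly increasing chain of ideals every step brings a new leading
exponent, and by Dickson's lemma some new one would be a multiple of an earlier one.
\<close>

lemma wf_ideals_mpoly:
  "wf {(B, A :: ('n::{finite,linorder}, 'k::field) mpoly set). is_ideal A \<and> is_ideal B \<and> A \<subset> B}"
  unfolding wf_iff_no_infinite_down_chain
proof
  assume "\<exists>f. \<forall>i. (f (Suc i), f i) \<in>
    {(B, A :: ('n, 'k) mpoly set). is_ideal A \<and> is_ideal B \<and> A \<subset> B}"
  then obtain J :: "nat \<Rightarrow> ('n, 'k) mpoly set"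
    where chain: "\<forall>i. (J (Suc i), J i) \<in> {(B, A). is_ideal A \<and> is_ideal B \<and> A \<subset> B}" by (rule exE)
  have J: "is_ideal (J i)" "J i \<subset> J (Suc i)" for i using chain[rule_format, of i] by simp_all
  have "\<exists>a. a \<in> leading_exponents (J (Suc i)) - leading_exponents (J i)" for i
    using eq_if_leading_exponents_subset[of "J i" "J (Suc i)"] J by blast
  then obtain a where a: "\<And>i. a i \<in> leading_exponents (J (Suc i)) - leading_exponents (J i)" by metis
  obtain i j where ij: "i < j" "Poly_Mapping.lookup (a i) \<le> Poly_Mapping.lookup (a j)"
    using dickson[of "\<lambda>i. Poly_Mapping.lookup (a i)"] by blast
  have "J (Suc i) \<subseteq> J j" 
    by (rule lift_Suc_mono_le[of J]) (use ij(1) J(2) in auto)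
  then have "leading_exponents (J (Suc i)) \<subseteq> leading_exponents (J j)"
    unfolding leading_exponents_def by blast
  then have "a i \<in> leading_exponents (J j)" using a[of i] by blast
  moreover obtain c where "a j = a i + c" using ij(2) by (auto simp: lookup_le_iff_add)
  ultimately have "a j \<in> leading_exponents (J j)" using leading_exponents_add[OF J(1)] by simp
  with a[of j] show False by blast
qed

section \<open>Monomial ideals as sets of exponents\<close>

definition upward_closed :: "('n \<Rightarrow>\<^sub>0 nat) set \<Rightarrow> bool" where
  "upward_closed E \<longleftrightarrow> (\<forall>a\<in>E. \<forall>c. a + c \<in> E)"

text \<open>
For an upward closed \<open>E\<close> these are exactly the monomial ideals. The description by exponents is easier to
handle than one by generators, since membership can be read off term by term.
\<close>

definition mono_ideal :: "('n \<Rightarrow>\<^sub>0 nat) set \<Rightarrow> ('n, 'k::comm_ring_1) mpoly set" where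
  "mono_ideal E = {f. Poly_Mapping.keys f \<subseteq> E}"

lemma upward_closedD: "upward_closed E \<Longrightarrow> a \<in> E \<Longrightarrow> a + c \<in> E"
  by (simp add: upward_closed_def)

lemma is_ideal_mono_ideal: "upward_closed E \<Longrightarrow> is_ideal (mono_ideal E)"
proof (rule is_idealI)
  fix f g :: "('a, 'b) mpoly"
  assume E: "upward_closed E"
  show "f + g \<in> mono_ideal E" if "f \<in> mono_ideal E" "g \<in> mono_ideal E"
    using that keys_add[of f g] by (auto simp: mono_ideal_def)
  show "g * f \<in> mono_ideal E" if "f \<in> mono_ideal E"
  proof -
    have "a + b \<in> E" if "b \<in> Poly_Mapping.keys f" for a b
      using \<open>f \<in> mono_ideal E\<close> that upward_closedD[OF E, of b a] by (auto simp: mono_ideal_def add.commute)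
    then have "{a + b |a b. a \<in> Poly_Mapping.keys g \<and> b \<in> Poly_Mapping.keys f} \<subseteq> E" by blast
    with keys_mult[of g f] show ?thesis
      unfolding mono_ideal_def by simp
  qed
qed (simp add: mono_ideal_def)

lemma monom_of_mem_mono_ideal [simp]:
  "(monom_of a :: ('n, 'k::field) mpoly) \<in> mono_ideal E \<longleftrightarrow> a \<in> E"
  by (simp add: mono_ideal_def monom_of_def)

lemma mono_ideal_least:
  fixes J :: "('n, 'k::comm_ring_1) mpoly set"
  assumes J: "is_ideal J" and E: "\<And>a. a \<in> E \<Longrightarrow> monom_of a \<in> J"
  shows "mono_ideal E \<subseteq> J"
proof
  fix f :: "('n, 'k) mpoly"
  assume f: "f \<in> mono_ideal E"
  have "Poly_Mapping.single a (Poly_Mapping.lookup f a) \<in> J" if "a \<in> Poly_Mapping.keys f" for a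
  proof -
    have "Poly_Mapping.single 0 (Poly_Mapping.lookup f a) * monom_of a \<in> J"
      using f that E by (intro ideal_mult_left[OF J]) (auto simp: mono_ideal_def)
    then show ?thesis by (simp add: monom_of_def mult_single)
  qed
  then have "(\<Sum>a\<in>Poly_Mapping.keys f. Poly_Mapping.single a (Poly_Mapping.lookup f a)) \<in> J"
    by (intro module.subspace_sum[OF module_mult J])
  then show "f \<in> J" using mpoly_eq_sum_terms[of f] by simp
qed

lemma mono_ideal_subset_iff:
  "mono_ideal E \<subseteq> (mono_ideal E' :: ('n, 'k::field) mpoly set) \<longleftrightarrow> E \<subseteq> E'"
proof
  assume "mono_ideal E \<subseteq> (mono_ideal E' :: ('n, 'k) mpoly set)"
  then show "E \<subseteq> E'" using monom_of_mem_mono_ideal by blast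
qed (auto simp: mono_ideal_def)

lemma mono_ideal_eq_iff:
  "mono_ideal E = (mono_ideal E' :: ('n, 'k::field) mpoly set) \<longleftrightarrow> E = E'"
  by (simp add: set_eq_subset mono_ideal_subset_iff)

definition exponents_above :: "('n \<Rightarrow>\<^sub>0 nat) set \<Rightarrow> ('n \<Rightarrow>\<^sub>0 nat) set" where
  "exponents_above G = {v + c | v c. v \<in> G}"

lemma subset_exponents_above: "G \<subseteq> exponents_above G"
proof
  fix v assume "v \<in> G"
  then have "v = v + 0 \<and> v \<in> G" by simp
  then show "v \<in> exponents_above G" unfolding exponents_above_def by blast
qed

lemma upward_closed_above: "upward_closed (exponents_above G)"
  by (auto simp: upward_closed_def exponents_above_def) (metis add.assoc)

lemma ideal_gen_monom_of:
  "ideal_gen (monom_of ` G) = (mono_ideal (exponents_above G) :: ('n, 'k::field) mpoly set)"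
proof
  show "ideal_gen (monom_of ` G) \<subseteq> (mono_ideal (exponents_above G) :: ('n, 'k) mpoly set)"
  proof (rule ideal_gen_least)
    show "monom_of ` G \<subseteq> (mono_ideal (exponents_above G) :: ('n, 'k) mpoly set)"
      using subset_exponents_above[of G] by auto
  qed (rule is_ideal_mono_ideal[OF upward_closed_above])
  show "mono_ideal (exponents_above G) \<subseteq> (ideal_gen (monom_of ` G) :: ('n, 'k) mpoly set)"
  proof (rule mono_ideal_least[OF is_ideal_gen])
    fix a assume "a \<in> exponents_above G"
    then obtain v c where "v \<in> G" "a = c + v" by (auto simp: exponents_above_def add.commute)
    have "(monom_of v :: ('n, 'k) mpoly) \<in> ideal_gen (monom_of ` G)"
      using \<open>v \<in> G\<close> by (intro ideal_gen_superset imageI)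
    then show "(monom_of a :: ('n, 'k) mpoly) \<in> ideal_gen (monom_of ` G)"
      unfolding \<open>a = c + v\<close> monom_of_add by (rule ideal_mult_left[OF is_ideal_gen])
  qed
qed

lemma monomial_ideal_imp_mono_ideal:
  fixes J :: "('n, 'k::field) mpoly set"
  assumes "monomial_ideal J"
  obtains E where "upward_closed E" "J = mono_ideal E"
  using assms upward_closed_above by (auto simp: monomial_ideal_def ideal_gen_monom_of)

text \<open>
The convention \<open>E\<^sub>0 = UNIV\<close> matches the zeroth power of an ideal, which is the whole ring.
\<close>

primrec exponents_power :: "('n \<Rightarrow>\<^sub>0 nat) set \<Rightarrow> nat \<Rightarrow> ('n \<Rightarrow>\<^sub>0 nat) set" where
  "exponents_power E 0 = UNIV"
| "exponents_power E (Suc k) = {a + b | a b. a \<in> E \<and> b \<in> exponents_power E k}"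

lemma upward_closed_power: "upward_closed (exponents_power E k)"
proof (induction k)
  case (Suc k)
  show ?case
    unfolding upward_closed_def
  proof (intro ballI allI)
    fix x c assume "x \<in> exponents_power E (Suc k)"
    then obtain a b where "x = a + b" "a \<in> E" "b \<in> exponents_power E k" by auto
    then have "x + c = a + (b + c) \<and> a \<in> E \<and> b + c \<in> exponents_power E k"
      using upward_closedD[OF Suc] by (simp add: add.assoc)
    then show "x + c \<in> exponents_power E (Suc k)" unfolding exponents_power.simps by blast
  qed
qed (simp add: upward_closed_def)

lemma add_mem_exponents_power:
  assumes "a \<in> exponents_power E j" and "b \<in> exponents_power E k"
  shows "a + b \<in> exponents_power E (j + k)"
  using assms(1)
proof (induction j arbitrary: a)
  case 0
  show ?case using upward_closedD[OF upward_closed_power assms(2), of a] by (simp add: add.commute)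
next
  case (Suc j)
  then obtain u v where uv: "a = u + v" "u \<in> E" "v \<in> exponents_power E j" by auto
  then have "a + b = u + (v + b)" "v + b \<in> exponents_power E (j + k)"
    using Suc.IH by (simp_all add: add.assoc)
  then show ?case using uv(2) unfolding add_Suc exponents_power.simps by blast
qed

lemma ideal_power_mono_ideal:
  fixes E :: "('n \<Rightarrow>\<^sub>0 nat) set"
  shows "ideal_power (mono_ideal E) k = (mono_ideal (exponents_power E k) :: ('n, 'k::field) mpoly set)"
proof (induction k)
  case 0
  show ?case by (simp add: mono_ideal_def)
next
  case (Suc k)
  show ?case
  proof
    show "ideal_power (mono_ideal E) (Suc k) \<subseteq> (mono_ideal (exponents_power E (Suc k)) :: ('n, 'k) mpoly set)"
      unfolding ideal_power.simps
    proof (rule ideal_gen_least)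
      show "{a * b |a b. a \<in> mono_ideal E \<and> b \<in> ideal_power (mono_ideal E) k}
          \<subseteq> (mono_ideal (exponents_power E (Suc k)) :: ('n, 'k) mpoly set)"
        unfolding Suc
      proof clarify
        fix f g :: "('n, 'k) mpoly"
        assume "f \<in> mono_ideal E" "g \<in> mono_ideal (exponents_power E k)"
        then have "{a + b |a b. a \<in> Poly_Mapping.keys f \<and> b \<in> Poly_Mapping.keys g} \<subseteq> exponents_power E (Suc k)"
          unfolding mono_ideal_def exponents_power.simps by blast
        from order_trans[OF keys_mult this] show "f * g \<in> mono_ideal (exponents_power E (Suc k))"
          unfolding mono_ideal_def mem_Collect_eq .
      qed
    qed (rule is_ideal_mono_ideal[OF upward_closed_power])
    show "(mono_ideal (exponents_power E (Suc k)) :: ('n, 'k) mpoly set) \<subseteq> ideal_power (mono_ideal E) (Suc k)"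
    proof (rule mono_ideal_least[OF is_ideal_power])
      fix x assume "x \<in> exponents_power E (Suc k)"
      then obtain a b where x: "x = a + b" "a \<in> E" "b \<in> exponents_power E k" by auto
      then have "(monom_of a :: ('n, 'k) mpoly) \<in> mono_ideal E"
        "(monom_of b :: ('n, 'k) mpoly) \<in> ideal_power (mono_ideal E) k" by (simp_all add: Suc)
      then show "(monom_of x :: ('n, 'k) mpoly) \<in> ideal_power (mono_ideal E) (Suc k)"
        unfolding x(1) monom_of_add ideal_power.simps by (intro ideal_gen_superset) blast
    qed
  qed
qed

definition minimal_exponents :: "('n \<Rightarrow>\<^sub>0 nat) set \<Rightarrow> ('n \<Rightarrow>\<^sub>0 nat) set" where
  "minimal_exponents E = {v \<in> E. \<forall>u\<in>E. Poly_Mapping.lookup u \<le> Poly_Mapping.lookup v \<longrightarrow> u = v}"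

text \<open>
The minimal elements are the exponents of the minimal monomial generators; every exponent lies above one of
them by well-foundedness.
\<close>

lemma above_minimal_exponents:
  fixes E :: "('n::{finite,linorder} \<Rightarrow>\<^sub>0 nat) set"
  assumes "upward_closed E"
  shows "exponents_above (minimal_exponents E) = E"
proof
  show "exponents_above (minimal_exponents E) \<subseteq> E"
    using upward_closedD[OF assms] by (auto simp: exponents_above_def minimal_exponents_def)
  show "E \<subseteq> exponents_above (minimal_exponents E)"
  proof
    fix a assume "a \<in> E"
    then show "a \<in> exponents_above (minimal_exponents E)"
    proof (induction a rule: wf_induct_rule[OF wf_exponents])
      case (1 a)
      show ?case
      proof (cases "a \<in> minimal_exponents E")
        case True
        then show ?thesis using subset_exponents_above by blast
      next
        case False
        then obtain u where u: "u \<in> E" "Poly_Mapping.lookup u \<le> Poly_Mapping.lookup a" "u \<noteq> a"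
          using 1(2) by (auto simp: minimal_exponents_def)
        then obtain c where c: "a = u + c" by (auto simp: lookup_le_iff_add)
        then have "u < a" using exponent_le_add[of u c] u(3) by (metis le_neq_trans)
        then have "u \<in> exponents_above (minimal_exponents E)" using 1(1) u(1) by blast
        then show ?thesis using upward_closedD[OF upward_closed_above] c by blast
      qed
    qed
  qed
qed

lemma minimal_exponents_subset_generators:
  fixes G :: "('n::{finite,linorder} \<Rightarrow>\<^sub>0 nat) set"
  shows "minimal_exponents (exponents_above G) \<subseteq> G"
proof
  fix v assume v: "v \<in> minimal_exponents (exponents_above G)"
  then obtain u c where u: "u \<in> G" "v = u + c" by (auto simp: minimal_exponents_def exponents_above_def)
  have "u \<in> exponents_above G" using u(1) subset_exponents_above by blast
  moreover have "Poly_Mapping.lookup u \<le> Poly_Mapping.lookup v" using u(2) by (auto simp: lookup_le_iff_add)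
  ultimately show "v \<in> G" using u v by (auto simp: minimal_exponents_def)
qed

text \<open>
Any generating set contains the minimal exponents, which already generate, so an irredundant one equals them.
\<close>

lemma min_generators_mono_ideal:
  fixes E :: "('n::{finite,linorder} \<Rightarrow>\<^sub>0 nat) set"
  assumes E: "upward_closed E"
  shows "min_generators (mono_ideal E :: ('n, 'k::field) mpoly set) = minimal_exponents E"
  unfolding min_generators_def ideal_gen_monom_of mono_ideal_eq_iff
proof (rule the_equality)
  have "minimal_exponents E \<subseteq> H" if "E = exponents_above H" for H
    using minimal_exponents_subset_generators[of H] that by simp
  then show "E = exponents_above (minimal_exponents E) \<and>
      (\<forall>H. H \<subset> minimal_exponents E \<longrightarrow> E \<noteq> exponents_above H)"
    using above_minimal_exponents[OF E] by blast
next
  fix G assume G: "E = exponents_above G \<and> (\<forall>H. H \<subset> G \<longrightarrow> E \<noteq> exponents_above H)"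
  have "minimal_exponents E \<subseteq> G" using minimal_exponents_subset_generators G by blast
  then show "G = minimal_exponents E" using G above_minimal_exponents[OF E] by blast
qed

text \<open>
Minimal exponents are pairwise incomparable, so Dickson's lemma leaves room for only finitely many.
\<close>

lemma finite_minimal_exponents:
  fixes E :: "('n::{finite,linorder} \<Rightarrow>\<^sub>0 nat) set"
  shows "finite (minimal_exponents E)"
proof (rule ccontr)
  assume "infinite (minimal_exponents E)"
  then obtain a :: "nat \<Rightarrow> 'n \<Rightarrow>\<^sub>0 nat" where a: "inj a" "range a \<subseteq> minimal_exponents E"
    using infinite_countable_subset by blast
  obtain i j where ij: "i < j" "Poly_Mapping.lookup (a i) \<le> Poly_Mapping.lookup (a j)"
    using dickson[of "\<lambda>i. Poly_Mapping.lookup (a i)"] by blast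
  have "a i \<in> E" "a j \<in> minimal_exponents E" using a(2) by (auto simp: minimal_exponents_def)
  then have "a i = a j" using ij(2) by (auto simp: minimal_exponents_def)
  then show False using a(1) ij(1) by (auto dest: injD)
qed

section \<open>Saturation with respect to a set of variables\<close>

text \<open>
The property of exponent sets behind the ideals that are primary to the prime generated by the variables in
\<open>S\<close>: other variables neither help nor hinder membership.
\<close>

definition depends_only_on :: "'n set \<Rightarrow> ('n \<Rightarrow>\<^sub>0 nat) set \<Rightarrow> bool" where
  "depends_only_on S E \<longleftrightarrow>
    (\<forall>a b. (\<forall>i\<in>S. Poly_Mapping.lookup a i = Poly_Mapping.lookup b i) \<longrightarrow> a \<in> E \<longrightarrow> b \<in> E)"

lemma depends_only_onD:
  "depends_only_on S E \<Longrightarrow> (\<And>i. i \<in> S \<Longrightarrow> Poly_Mapping.lookup a i = Poly_Mapping.lookup b i) \<Longrightarrow> a \<in> E \<Longrightarrow> b \<in> E"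
  unfolding depends_only_on_def by blast

text \<open>
The hypothesis on \<open>b\<close> says that \<open>s\<close> lies outside the prime generated by the variables in \<open>S\<close>, so this is
saturation with respect to that prime, and taking \<open>E\<close> to be its set of exponents shows that it is prime.
Among the exponents of \<open>f\<close> outside \<open>E\<close> pick \<open>a0\<close> of
least total degree in the variables in \<open>S\<close> and, among those, lexicographically least; pick \<open>b0\<close> for \<open>s\<close>
likewise, with degree \<open>0\<close>. Then \<open>b0 + a0\<close> splits uniquely, so it is an exponent of \<open>s f\<close>, although it is not
in \<open>E\<close>.
\<close>

lemma mono_ideal_cancel:
  fixes f s :: "('n::{finite,linorder}, 'k::field) mpoly"
  assumes E: "upward_closed E" and dep: "depends_only_on S E" and sf: "s * f \<in> mono_ideal E"
    and b: "b \<in> Poly_Mapping.keys s" "\<And>i. i \<in> S \<Longrightarrow> Poly_Mapping.lookup b i = 0"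
  shows "f \<in> mono_ideal E"
proof (rule ccontr)
  assume "f \<notin> mono_ideal E"
  define w where "w a = (\<Sum>i\<in>S. Poly_Mapping.lookup a i)" for a :: "'n \<Rightarrow>\<^sub>0 nat"
  have w_add: "w (a + c) = w a + w c" for a c by (simp add: w_def lookup_add sum.distrib)
  define A where "A = Poly_Mapping.keys f - E"
  define m where "m = Min (w ` A)"
  define a0 where "a0 = Min {a \<in> A. w a = m}"
  define b0 where "b0 = Min {b \<in> Poly_Mapping.keys s. w b = 0}"
  have A: "finite A" "A \<noteq> {}" using \<open>f \<notin> mono_ideal E\<close> by (auto simp: A_def mono_ideal_def)
  have m: "m \<le> w a" if "a \<in> A" for a unfolding m_def using A that by simp
  have "m \<in> w ` A" unfolding m_def using A by (intro Min_in) auto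
  then have "{a \<in> A. w a = m} \<noteq> {}" by auto
  then have "a0 \<in> {a \<in> A. w a = m}" unfolding a0_def using A(1) by (intro Min_in) auto
  then have a0: "a0 \<in> A" "w a0 = m" by simp_all
  have a0_le: "a0 \<le> a" if "a \<in> A" "w a = m" for a
    unfolding a0_def using that A(1) by (intro Min_le) auto
  have "{b \<in> Poly_Mapping.keys s. w b = 0} \<noteq> {}" using b by (auto simp: w_def)
  then have "b0 \<in> {b \<in> Poly_Mapping.keys s. w b = 0}" unfolding b0_def by (intro Min_in) auto
  then have b0: "b0 \<in> Poly_Mapping.keys s" "w b0 = 0" by simp_all
  have b0_le: "b0 \<le> b" if "b \<in> Poly_Mapping.keys s" "w b = 0" for b
    unfolding b0_def using that by (intro Min_le) auto
  have sum_notin: "b0 + a0 \<notin> E"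
  proof
    assume "b0 + a0 \<in> E"
    moreover have "Poly_Mapping.lookup (b0 + a0) i = Poly_Mapping.lookup a0 i" if "i \<in> S" for i
      using b0(2) that by (simp add: w_def lookup_add)
    ultimately have "a0 \<in> E" using depends_only_onD[OF dep] by blast
    then show False using a0(1) by (simp add: A_def)
  qed
  have uniq: "u = b0" if u: "u \<in> Poly_Mapping.keys s" and v: "v \<in> Poly_Mapping.keys f"
    and uv: "u + v = b0 + a0" for u v
  proof -
    \<comment> \<open>terms of \<open>f\<close> inside \<open>E\<close> only contribute exponents inside \<open>E\<close>\<close>
    have "v \<notin> E" using upward_closedD[OF E, of v u] sum_notin uv by (auto simp: add.commute)
    then have "v \<in> A" using v by (simp add: A_def)
    then have "m \<le> w v" by (rule m)
    moreover have "w u + w v = m" using uv w_add[of u v] w_add[of b0 a0] a0(2) b0(2) by simp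
    ultimately have "w u = 0" "w v = m" by auto
    then have le: "b0 \<le> u" "a0 \<le> v" using b0_le a0_le u \<open>v \<in> A\<close> by auto
    show "u = b0"
    proof (rule ccontr)
      assume "u \<noteq> b0"
      then have "b0 + a0 < u + v" using le by (intro add_less_le_mono) auto
      then show False using uv by simp
    qed
  qed
  have "Poly_Mapping.lookup (s * f) (b0 + a0) = Poly_Mapping.lookup s b0 * Poly_Mapping.lookup f a0"
    using uniq by (rule lookup_mult_unique)
  also have "\<dots> \<noteq> 0" using a0(1) b0(1) by (simp add: A_def in_keys_iff)
  finally have "b0 + a0 \<in> Poly_Mapping.keys (s * f)" by (simp add: in_keys_iff)
  then show False using sf sum_notin by (auto simp: mono_ideal_def)
qed

section \<open>Primary components of a monomial ideal\<close>

text \<open>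
The exponents of the ideal generated by the variables in \<open>S\<close>.
\<close>

definition var_exponents :: "'n set \<Rightarrow> ('n \<Rightarrow>\<^sub>0 nat) set" where
  "var_exponents S = {a. \<exists>i\<in>S. Poly_Mapping.lookup a i \<noteq> 0}"

abbreviation var :: "'n \<Rightarrow> ('n, 'k::comm_ring_1) mpoly" where
  "var i \<equiv> monom_of (Poly_Mapping.single i 1)"

lemma upward_closed_var_exponents: "upward_closed (var_exponents S)"
  by (auto simp: upward_closed_def var_exponents_def lookup_add)

lemma depends_only_on_var_exponents: "depends_only_on S (var_exponents S)"
  unfolding depends_only_on_def var_exponents_def by fastforce

lemma prime_ideal_var_exponents:
  "prime_ideal (mono_ideal (var_exponents S) :: ('n::{finite,linorder}, 'k::field) mpoly set)"
  unfolding prime_ideal_def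
proof (intro conjI allI impI)
  show "is_ideal (mono_ideal (var_exponents S) :: ('n, 'k) mpoly set)"
    by (rule is_ideal_mono_ideal[OF upward_closed_var_exponents])
  have "(monom_of 0 :: ('n, 'k) mpoly) \<notin> mono_ideal (var_exponents S)"
    unfolding monom_of_mem_mono_ideal by (simp add: var_exponents_def)
  then show "(mono_ideal (var_exponents S) :: ('n, 'k) mpoly set) \<noteq> UNIV" by blast
  fix s f :: "('n, 'k) mpoly"
  assume sf: "s * f \<in> mono_ideal (var_exponents S)"
  show "s \<in> mono_ideal (var_exponents S) \<or> f \<in> mono_ideal (var_exponents S)"
    unfolding disj_imp
  proof
    assume "s \<notin> mono_ideal (var_exponents S)"
    then obtain b where "b \<in> Poly_Mapping.keys s" "b \<notin> var_exponents S" by (auto simp: mono_ideal_def)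
    then show "f \<in> mono_ideal (var_exponents S)"
      by - (rule mono_ideal_cancel[OF upward_closed_var_exponents depends_only_on_var_exponents sf],
          auto simp: var_exponents_def)
  qed
qed

text \<open>
A monomial is a product of powers of its variables.
\<close>

lemma prime_ideal_monom_of:
  fixes P :: "('n::{finite,linorder}, 'k::field) mpoly set"
  assumes P: "prime_ideal P" and a: "monom_of a \<in> P"
  shows "\<exists>i. Poly_Mapping.lookup a i \<noteq> 0 \<and> var i \<in> P"
proof (rule ccontr)
  assume *: "\<not> ?thesis"
  have "a = (\<Sum>i\<in>UNIV. Poly_Mapping.single i (Poly_Mapping.lookup a i))"
    by (rule poly_mapping_eqI) (simp add: lookup_sum lookup_single when_def)
  then have "monom_of a = (\<Prod>i\<in>UNIV. (var i :: ('n, 'k) mpoly) ^ Poly_Mapping.lookup a i)"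
    unfolding monom_of_single_power monom_of_sum[symmetric] by (rule arg_cong)
  moreover have "(var i :: ('n, 'k) mpoly) ^ Poly_Mapping.lookup a i \<notin> P" for i
  proof (cases "Poly_Mapping.lookup a i = 0")
    case False
    then have "var i \<notin> P" using * by blast
    then show ?thesis by (rule prime_ideal_power_notin[OF P])
  qed (simp add: prime_ideal_one[OF P])
  then have "(\<Prod>i\<in>UNIV. (var i :: ('n, 'k) mpoly) ^ Poly_Mapping.lookup a i) \<notin> P"
    by (rule prime_ideal_prod_notin[OF P])
  ultimately show False using a by simp
qed

text \<open>
The variables in \<open>P\<close> generate a prime inside \<open>P\<close>. It contains the monomial ideal, because a prime
containing a monomial contains one of its variables.
\<close>

lemma minimal_prime_mono_ideal:
  fixes P :: "('n::{finite,linorder}, 'k::field) mpoly set"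
  assumes P: "minimal_prime (mono_ideal E) P"
  shows "P = mono_ideal (var_exponents {i. var i \<in> P})"
proof -
  let ?S = "{i. (var i :: ('n, 'k) mpoly) \<in> P}"
  have prime: "prime_ideal P" and EP: "mono_ideal E \<subseteq> P"
    and least: "\<And>P'. prime_ideal P' \<Longrightarrow> mono_ideal E \<subseteq> P' \<Longrightarrow> P' \<subseteq> P \<Longrightarrow> P' = P"
    using P by (auto simp: minimal_prime_def)
  have "E \<subseteq> var_exponents ?S"
  proof
    fix a assume "a \<in> E"
    then have "(monom_of a :: ('n, 'k) mpoly) \<in> mono_ideal E" by simp
    then have "(monom_of a :: ('n, 'k) mpoly) \<in> P" using EP by blast
    then show "a \<in> var_exponents ?S"
      using prime_ideal_monom_of[OF prime] by (auto simp: var_exponents_def)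
  qed
  then have "mono_ideal E \<subseteq> (mono_ideal (var_exponents ?S) :: ('n, 'k) mpoly set)"
    by (simp add: mono_ideal_subset_iff)
  moreover have "mono_ideal (var_exponents ?S) \<subseteq> P"
  proof (rule mono_ideal_least[OF prime_ideal_ideal[OF prime]])
    fix a assume "a \<in> var_exponents ?S"
    then obtain i where i: "var i \<in> P" "Poly_Mapping.lookup a i \<noteq> 0" by (auto simp: var_exponents_def)
    have "Poly_Mapping.lookup (Poly_Mapping.single i 1) \<le> Poly_Mapping.lookup a"
      using i(2) by (auto simp: le_fun_def lookup_single when_def)
    then obtain c where "a = Poly_Mapping.single i 1 + c" by (auto simp: lookup_le_iff_add)
    then show "monom_of a \<in> P"
      using ideal_mult_right[OF prime_ideal_ideal[OF prime] i(1)] by (simp add: monom_of_add)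
  qed
  ultimately show ?thesis using least[OF prime_ideal_var_exponents] by blast
qed

text \<open>
The radicals of the components are distinct minimal primes, so each radical other than that of \<open>Q\<close> contains a
variable outside the latter. A power of this variable lies in the corresponding component, and \<open>x\<^sup>c\<close> is the
product of these powers. For \<open>f \<in> Q\<close> the product \<open>x\<^sup>c f\<close> then lies in every component; conversely \<open>x\<^sup>c\<close> can be
cancelled because \<open>Q\<close> is primary.
\<close>

lemma component_eq_colon:
  fixes E :: "('n::{finite,linorder} \<Rightarrow>\<^sub>0 nat) set" and C :: "('n, 'k::field) mpoly set set"
  assumes C: "minimal_primary_decomposition (mono_ideal E) C"
    and min: "\<And>Q. Q \<in> C \<Longrightarrow> minimal_prime (mono_ideal E) (radical_ideal Q)"
    and Q: "Q \<in> C"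
  shows "\<exists>c. monom_of c \<notin> radical_ideal Q \<and> Q = {f. monom_of c * f \<in> mono_ideal E}"
proof -
  have fin: "finite C" and I: "\<Inter>C = mono_ideal E" and inj: "inj_on radical_ideal C"
    and primary: "\<And>Q. Q \<in> C \<Longrightarrow> primary_ideal Q"
    using C unfolding minimal_primary_decomposition_def by simp_all
  have prime: "prime_ideal (radical_ideal Q)" using min[OF Q] by (simp add: minimal_prime_def)
  have "\<exists>i m. var i \<notin> radical_ideal Q \<and> (var i :: ('n, 'k) mpoly) ^ m \<in> Q'" if Q': "Q' \<in> C - {Q}" for Q'
  proof -
    have "radical_ideal Q' \<noteq> radical_ideal Q" using inj Q Q' by (auto dest: inj_onD)
    then have not_sub: "\<not> radical_ideal Q' \<subseteq> radical_ideal Q"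
      using min[OF Q] min[of Q'] Q' by (auto simp: minimal_prime_def)
    have "\<exists>i. (var i :: ('n, 'k) mpoly) \<in> radical_ideal Q' \<and> var i \<notin> radical_ideal Q"
    proof (rule ccontr)
      assume "\<not> ?thesis"
      then have "var_exponents {i. (var i :: ('n, 'k) mpoly) \<in> radical_ideal Q'}
          \<subseteq> var_exponents {i. (var i :: ('n, 'k) mpoly) \<in> radical_ideal Q}"
        by (auto simp: var_exponents_def)
      then have "(mono_ideal (var_exponents {i. (var i :: ('n, 'k) mpoly) \<in> radical_ideal Q'}) :: ('n, 'k) mpoly set)
          \<subseteq> mono_ideal (var_exponents {i. (var i :: ('n, 'k) mpoly) \<in> radical_ideal Q})"
        by (simp only: mono_ideal_subset_iff)
      then show False
        using not_sub minimal_prime_mono_ideal[OF min[OF Q]] minimal_prime_mono_ideal[OF min, of Q'] Q' by auto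
    qed
    then show ?thesis by (auto simp: radical_ideal_def)
  qed
  then obtain v e where ve: "\<And>Q'. Q' \<in> C - {Q} \<Longrightarrow>
      var (v Q') \<notin> radical_ideal Q \<and> (var (v Q') :: ('n, 'k) mpoly) ^ e Q' \<in> Q'" by metis
  define c where "c = (\<Sum>Q'\<in>C - {Q}. Poly_Mapping.single (v Q') (e Q'))"
  have c: "monom_of c = (\<Prod>Q'\<in>C - {Q}. (var (v Q') :: ('n, 'k) mpoly) ^ e Q')"
    unfolding c_def monom_of_sum monom_of_single_power ..
  have notin: "monom_of c \<notin> radical_ideal Q"
    unfolding c using ve prime_ideal_power_notin[OF prime] by (intro prime_ideal_prod_notin[OF prime]) blast
  have c_in: "monom_of c \<in> Q'" if Q': "Q' \<in> C - {Q}" for Q'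
  proof -
    have "is_ideal Q'" using primary Q' by (auto intro: primary_ideal_ideal)
    moreover have "monom_of c = var (v Q') ^ e Q' * (\<Prod>Q'\<in>C - {Q} - {Q'}. (var (v Q') :: ('n, 'k) mpoly) ^ e Q')"
      unfolding c using fin Q' by (intro prod.remove) auto
    ultimately show ?thesis using ve[OF Q'] by (auto intro: ideal_mult_right)
  qed
  have "Q = {f. monom_of c * f \<in> mono_ideal E}"
  proof (intro equalityI subsetI)
    fix f assume f: "f \<in> Q"
    have "monom_of c * f \<in> Q'" if "Q' \<in> C" for Q'
    proof (cases "Q' = Q")
      case True
      then show ?thesis using ideal_mult_left[OF primary_ideal_ideal[OF primary[OF Q]] f] by simp
    next
      case False
      then show ?thesis
        using c_in[of Q'] that primary ideal_mult_right[OF primary_ideal_ideal] by blast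
    qed
    then show "f \<in> {f. monom_of c * f \<in> mono_ideal E}" using I by auto
  next
    fix f :: "('n, 'k) mpoly"
    assume "f \<in> {f. monom_of c * f \<in> mono_ideal E}"
    then have "f * monom_of c \<in> Q" using I Q by (auto simp: mult.commute)
    then show "f \<in> Q" using primary_idealD[OF primary[OF Q]] notin by blast
  qed
  with notin show ?thesis by blast
qed

lemma colon_monom_of:
  fixes E :: "('n::{finite,linorder} \<Rightarrow>\<^sub>0 nat) set"
  shows "{f. monom_of c * f \<in> mono_ideal E} = (mono_ideal {a. c + a \<in> E} :: ('n, 'k::field) mpoly set)"
  by (auto simp: mono_ideal_def keys_monom_mult)

text \<open>
Change a decomposition \<open>a = u + v\<close> of the given exponent into one of \<open>b\<close> by moving all variables outside \<open>S\<close>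
to the second summand.
\<close>

lemma depends_only_on_power:
  fixes E :: "('n::{finite,linorder} \<Rightarrow>\<^sub>0 nat) set"
  assumes dep: "depends_only_on S E"
  shows "depends_only_on S (exponents_power E k)"
proof (induction k)
  case (Suc k)
  show ?case
    unfolding depends_only_on_def
  proof (intro allI impI)
    fix a b assume ab: "\<forall>i\<in>S. Poly_Mapping.lookup a i = Poly_Mapping.lookup b i" and "a \<in> exponents_power E (Suc k)"
    then obtain u v where uv: "a = u + v" "u \<in> E" "v \<in> exponents_power E k" by auto
    define u' where "u' = Abs_poly_mapping (\<lambda>i. if i \<in> S then Poly_Mapping.lookup u i else 0)"
    have u': "Poly_Mapping.lookup u' i = (if i \<in> S then Poly_Mapping.lookup u i else 0)" for i
      unfolding u'_def by simp
    have "u' \<in> E" using uv(2) by (rule depends_only_onD[OF dep, rotated]) (simp add: u')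
    moreover have "b - u' \<in> exponents_power E k"
      using uv(3) by (rule depends_only_onD[OF Suc, rotated]) (use ab in \<open>simp add: uv(1) u' lookup_minus lookup_add flip: ab\<close>)
    moreover have "b = u' + (b - u')"
    proof (rule poly_mapping_eqI)
      fix i
      show "Poly_Mapping.lookup b i = Poly_Mapping.lookup (u' + (b - u')) i"
        using ab[rule_format, of i] by (auto simp: u' lookup_add lookup_minus uv(1))
    qed
    ultimately show "b \<in> exponents_power E (Suc k)" unfolding exponents_power.simps by blast
  qed
qed (simp add: depends_only_on_def)

lemma mult_power_mem_ideal_power:
  fixes Q J :: "'a::comm_ring_1 set"
  assumes sQ: "\<And>x. x \<in> Q \<Longrightarrow> s * x \<in> J" and f: "f \<in> ideal_power Q k"
  shows "s ^ k * f \<in> ideal_power J k"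
  using f
proof (induction k arbitrary: f)
  case (Suc k)
  define T where "T = {f. s ^ Suc k * f \<in> ideal_power J (Suc k)}"
  have "ideal_power Q (Suc k) \<subseteq> T"
    unfolding ideal_power.simps
  proof (rule ideal_gen_least)
    show "{a * b |a b. a \<in> Q \<and> b \<in> ideal_power Q k} \<subseteq> T"
    proof clarify
      fix a b assume "a \<in> Q" "b \<in> ideal_power Q k"
      then have "s * a \<in> J" "s ^ k * b \<in> ideal_power J k" using sQ Suc.IH by blast+
      then have "(s * a) * (s ^ k * b) \<in> ideal_power J (Suc k)"
        unfolding ideal_power.simps by (intro ideal_gen_superset) blast
      then show "a * b \<in> T" unfolding T_def by (simp add: ac_simps)
    qed
    show "is_ideal T"
      unfolding T_def
    proof (rule is_idealI; unfold mem_Collect_eq)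
      note J = is_ideal_power[of J "Suc k"]
      show "s ^ Suc k * 0 \<in> ideal_power J (Suc k)" using ideal_zero[OF J] by (simp only: mult_zero_right)
      show "s ^ Suc k * (x + y) \<in> ideal_power J (Suc k)"
        if "s ^ Suc k * x \<in> ideal_power J (Suc k)" "s ^ Suc k * y \<in> ideal_power J (Suc k)" for x y
        using ideal_add[OF J that] by (simp only: distrib_left)
      show "s ^ Suc k * (d * x) \<in> ideal_power J (Suc k)" if "s ^ Suc k * x \<in> ideal_power J (Suc k)" for d x
        using ideal_mult_left[OF J that, of d] by (simp only: mult.left_commute)
    qed
  qed
  then show ?case using Suc.prems unfolding T_def by blast
qed simp

text \<open>
After localisation at the radical of \<open>Q\<close>, the \<open>k\<close>-th powers of the ideal and of \<open>Q\<close> agree: in one direction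
multiply by the power \<open>s\<^sup>k\<close> of the monomial with \<open>Q = (I : s)\<close>, in the other direction use that
\<open>Q\<^sup>k\<close> is saturated.
\<close>

lemma symbolic_power_eq_Inter:
  fixes E :: "('n::{finite,linorder} \<Rightarrow>\<^sub>0 nat) set" and C :: "('n, 'k::field) mpoly set set"
  assumes E: "upward_closed E" and C: "minimal_primary_decomposition (mono_ideal E) C"
    and min: "\<And>Q. Q \<in> C \<Longrightarrow> minimal_prime (mono_ideal E) (radical_ideal Q)"
  shows "symbolic_power (mono_ideal E) k = (\<Inter>Q\<in>C. ideal_power Q k)"
proof -
  have "(\<exists>s. s \<notin> radical_ideal Q \<and> s * f \<in> ideal_power (mono_ideal E) k) \<longleftrightarrow> f \<in> ideal_power Q k"
    if Q: "Q \<in> C" for Q f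
  proof
    have primary: "primary_ideal Q" using C Q by (simp add: minimal_primary_decomposition_def)
    have prime: "prime_ideal (radical_ideal Q)" using min[OF Q] by (simp add: minimal_prime_def)
    obtain c where c: "monom_of c \<notin> radical_ideal Q" "Q = {f. monom_of c * f \<in> mono_ideal E}"
      using component_eq_colon[OF C min Q] by blast
    define F where "F = {a. c + a \<in> E}"
    have QF: "Q = mono_ideal F" using c(2) by (simp add: colon_monom_of F_def)
    {
      assume "f \<in> ideal_power Q k"
      then have "monom_of c ^ k * f \<in> ideal_power (mono_ideal E) k"
        by (rule mult_power_mem_ideal_power[rotated]) (use c(2) in blast)
      then show "\<exists>s. s \<notin> radical_ideal Q \<and> s * f \<in> ideal_power (mono_ideal E) k"
        using prime_ideal_power_notin[OF prime c(1)] by blast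
    }
    define S where "S = {i. (var i :: ('n, 'k) mpoly) \<in> radical_ideal Q}"
    have rad: "radical_ideal Q = mono_ideal (var_exponents S)"
      using minimal_prime_mono_ideal[OF min[OF Q]] by (simp add: S_def)
    have F: "upward_closed F"
      using upward_closedD[OF E] by (auto simp: upward_closed_def F_def simp flip: add.assoc)
    have dep: "depends_only_on S F"
      unfolding depends_only_on_def
    proof (intro allI impI)
      fix a b assume ab: "\<forall>i\<in>S. Poly_Mapping.lookup a i = Poly_Mapping.lookup b i" and a: "a \<in> F"
      define off where "off d = Abs_poly_mapping (\<lambda>i. if i \<in> S then 0 else Poly_Mapping.lookup d i)"
        for d :: "'n \<Rightarrow>\<^sub>0 nat"
      have off: "Poly_Mapping.lookup (off d) i = (if i \<in> S then 0 else Poly_Mapping.lookup d i)" for d i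
        unfolding off_def by simp
      \<comment> \<open>\<open>b\<close> becomes an exponent of \<open>Q\<close> after multiplication by a monomial outside the radical\<close>
      have "b + off a = a + off b"
        by (rule poly_mapping_eqI) (use ab in \<open>auto simp: lookup_add off\<close>)
      then have "b + off a \<in> F" using upward_closedD[OF F a] by simp
      then have "monom_of b * monom_of (off a) \<in> Q" unfolding QF monom_of_add[symmetric] by simp
      moreover have "monom_of (off a) \<notin> radical_ideal Q"
        unfolding rad monom_of_mem_mono_ideal by (simp add: var_exponents_def off)
      ultimately have "monom_of b \<in> Q" using primary_idealD[OF primary] by blast
      then show "b \<in> F" by (simp add: QF)
    qed
    assume "\<exists>s. s \<notin> radical_ideal Q \<and> s * f \<in> ideal_power (mono_ideal E) k"
    then obtain s where s: "s \<notin> radical_ideal Q" "s * f \<in> ideal_power (mono_ideal E) k" by blast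
    have "mono_ideal E \<subseteq> Q" using C Q by (auto simp: minimal_primary_decomposition_def)
    then have "s * f \<in> ideal_power Q k" using s(2) ideal_power_mono by blast
    then have sf: "s * f \<in> mono_ideal (exponents_power F k)" unfolding QF ideal_power_mono_ideal .
    obtain b where "b \<in> Poly_Mapping.keys s" "b \<notin> var_exponents S"
      using s(1) by (auto simp: rad mono_ideal_def)
    then have "f \<in> mono_ideal (exponents_power F k)"
      by - (rule mono_ideal_cancel[OF upward_closed_power depends_only_on_power[OF dep] sf],
          auto simp: var_exponents_def)
    then show "f \<in> ideal_power Q k" unfolding QF ideal_power_mono_ideal .
  qed
  note saturated = this
  have primes: "minimal_prime (mono_ideal E) P \<longleftrightarrow> P \<in> radical_ideal ` C" for P
    by (rule minimal_primes_eq_radicals[OF C]) (rule min)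
  have "f \<in> symbolic_power (mono_ideal E) k \<longleftrightarrow> (\<forall>Q\<in>C. f \<in> ideal_power Q k)" for f
  proof -
    have "f \<in> symbolic_power (mono_ideal E) k \<longleftrightarrow>
        (\<forall>P\<in>radical_ideal ` C. \<exists>s. s \<notin> P \<and> s * f \<in> ideal_power (mono_ideal E) k)"
      unfolding symbolic_power_iff primes by (simp only: Ball_def)
    also have "\<dots> \<longleftrightarrow> (\<forall>Q\<in>C. f \<in> ideal_power Q k)"
      unfolding ball_simps by (rule ball_cong[OF refl saturated])
    finally show ?thesis .
  qed
  then show ?thesis by blast
qed

section \<open>The Rees cone and its lattice points\<close>

definition cone_generators :: "('n::finite \<Rightarrow>\<^sub>0 nat) set \<Rightarrow> ((real ^ 'n) \<times> real) set" where
  "cone_generators E = range (\<lambda>i. (axis i 1, 0)) \<union> (\<lambda>v. (exponent_vec v, 1)) ` minimal_exponents E"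

text \<open>
The Rees cone in terms of exponents, which frees the arguments about cones from the coefficient field.
\<close>

definition exponent_cone :: "('n::finite \<Rightarrow>\<^sub>0 nat) set \<Rightarrow> ((real ^ 'n) \<times> real) set" where
  "exponent_cone E = convex_cone hull cone_generators E"

lemma rees_cone_eq_exponent_cone:
  fixes E :: "('n::{finite,linorder} \<Rightarrow>\<^sub>0 nat) set"
  assumes "upward_closed E"
  shows "rees_cone (mono_ideal E :: ('n, 'k::field) mpoly set) = exponent_cone E"
  unfolding rees_cone_def exponent_cone_def cone_generators_def min_generators_mono_ideal[OF assms] ..

lemma finite_cone_generators:
  fixes E :: "('n::{finite,linorder} \<Rightarrow>\<^sub>0 nat) set"
  shows "finite (cone_generators E)"
  by (simp add: cone_generators_def finite_minimal_exponents)

lemma closed_exponent_cone: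
  fixes E :: "('n::{finite,linorder} \<Rightarrow>\<^sub>0 nat) set"
  shows "closed (exponent_cone E)"
  unfolding exponent_cone_def by (rule closed_convex_cone_hull[OF finite_cone_generators])

lemma convex_cone_exponent_cone: "convex_cone (exponent_cone E)"
  unfolding exponent_cone_def by (rule convex_cone_convex_cone_hull)

lemma convex_cone_sum:
  assumes "convex_cone K" and "\<And>i. i \<in> A \<Longrightarrow> f i \<in> K"
  shows "(\<Sum>i\<in>A. f i) \<in> K"
  using assms(2)
  by (induction A rule: infinite_finite_induct)
     (auto simp: convex_cone_contains_0[OF assms(1)] intro: convex_cone_add[OF assms(1)])

text \<open>
The unit vectors are among the generators.
\<close>

lemma exponent_cone_upward:
  fixes x y :: "real ^ 'n::finite"
  assumes x: "(x, t) \<in> exponent_cone E" and le: "\<And>i. x $ i \<le> y $ i"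
  shows "(y, t) \<in> exponent_cone E"
proof -
  have "(\<Sum>i\<in>UNIV. (y $ i - x $ i) *\<^sub>R (axis i 1, 0)) \<in> exponent_cone E"
  proof (rule convex_cone_sum[OF convex_cone_exponent_cone])
    fix i
    have "(axis i 1, 0) \<in> exponent_cone E"
      unfolding exponent_cone_def by (rule hull_inc) (simp add: cone_generators_def)
    then show "(y $ i - x $ i) *\<^sub>R (axis i 1, 0) \<in> exponent_cone E"
      using le[of i] by (intro convex_cone_scaleR[OF convex_cone_exponent_cone]) simp_all
  qed
  also have "(\<Sum>i\<in>UNIV. (y $ i - x $ i) *\<^sub>R (axis i 1 :: real ^ 'n, 0 :: real)) = (y - x, 0)"
  proof -
    have "y - x = (\<Sum>i\<in>UNIV. (y - x) $ i *\<^sub>R axis i 1)"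
      using basis_expansion[of "y - x"] by (simp add: scalar_mult_eq_scaleR)
    then show ?thesis by (simp add: sum_prod scaleR_prod_def prod_eq_iff fst_sum snd_sum)
  qed
  finally have "(x, t) + (y - x, 0) \<in> exponent_cone E"
    by (rule convex_cone_add[OF convex_cone_exponent_cone x])
  then show ?thesis by simp
qed

lemma exponent_cone_nonneg:
  assumes "(x, t) \<in> exponent_cone E"
  shows "0 \<le> t" and "0 \<le> x $ i"
proof -
  have "exponent_cone E \<subseteq> {p. 0 \<le> snd p \<and> (\<forall>i. 0 \<le> fst p $ i)}"
    unfolding exponent_cone_def
    by (rule hull_minimal) (auto simp: cone_generators_def exponent_vec_def axis_def convex_cone_iff)
  with assms show "0 \<le> t" "0 \<le> x $ i" by auto
qed

lemma exponent_vec_add: "exponent_vec (a + b) = exponent_vec a + exponent_vec b"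
  by (simp add: exponent_vec_def vec_eq_iff lookup_add)

lemma exponent_mem_exponent_cone:
  fixes E :: "('n::{finite,linorder} \<Rightarrow>\<^sub>0 nat) set"
  assumes E: "upward_closed E" and a: "a \<in> E"
  shows "(exponent_vec a, 1) \<in> exponent_cone E"
proof -
  obtain v c where v: "v \<in> minimal_exponents E" "a = v + c"
    using a above_minimal_exponents[OF E] unfolding exponents_above_def by blast
  have "(exponent_vec v, 1) \<in> exponent_cone E"
    unfolding exponent_cone_def by (rule hull_inc) (simp add: cone_generators_def v(1))
  then show ?thesis
    by (rule exponent_cone_upward) (simp add: v(2) exponent_vec_def lookup_add)
qed

lemma power_mem_exponent_cone:
  fixes E :: "('n::{finite,linorder} \<Rightarrow>\<^sub>0 nat) set"
  assumes E: "upward_closed E" and a: "a \<in> exponents_power E k"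
  shows "(exponent_vec a, real k) \<in> exponent_cone E"
  using a
proof (induction k arbitrary: a)
  case 0
  have "(0, 0) \<in> exponent_cone E"
    using convex_cone_contains_0[OF convex_cone_exponent_cone, of E] by (simp add: zero_prod_def)
  then have "(exponent_vec a, 0) \<in> exponent_cone E"
    by (rule exponent_cone_upward) (simp add: exponent_vec_def)
  then show ?case by simp
next
  case (Suc k)
  then obtain b c where bc: "a = b + c" "b \<in> E" "c \<in> exponents_power E k" by auto
  have "(exponent_vec b, 1) + (exponent_vec c, real k) \<in> exponent_cone E"
    using exponent_mem_exponent_cone[OF E bc(2)] Suc.IH[OF bc(3)]
    by (rule convex_cone_add[OF convex_cone_exponent_cone])
  then show ?case by (simp add: bc(1) exponent_vec_add)
qed

lemma exponent_cone_mono: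
  fixes E F :: "('n::{finite,linorder} \<Rightarrow>\<^sub>0 nat) set"
  assumes F: "upward_closed F" and EF: "E \<subseteq> F"
  shows "exponent_cone E \<subseteq> exponent_cone F"
  unfolding exponent_cone_def[of E]
proof (rule hull_minimal)
  show "cone_generators E \<subseteq> exponent_cone F"
  proof
    fix p assume p: "p \<in> cone_generators E"
    show "p \<in> exponent_cone F"
    proof (cases "p \<in> range (\<lambda>i. (axis i 1, 0))")
      case True
      then show ?thesis unfolding exponent_cone_def by (intro hull_inc) (simp add: cone_generators_def)
    next
      case False
      then obtain v where "v \<in> E" "p = (exponent_vec v, 1)"
        using p by (auto simp: cone_generators_def minimal_exponents_def)
      then show ?thesis using exponent_mem_exponent_cone[OF F] EF by blast
    qed
  qed
qed (rule convex_cone_exponent_cone)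

lemma convex_cone_hull_finite_sum:
  assumes "finite G" and "p \<in> convex_cone hull G"
  shows "\<exists>l. (\<forall>g. 0 \<le> l g) \<and> p = (\<Sum>g\<in>G. l g *\<^sub>R g)"
proof -
  define K where "K = {p. \<exists>l. (\<forall>g. 0 \<le> l g) \<and> p = (\<Sum>g\<in>G. l g *\<^sub>R g)}"
  have KI: "(\<Sum>g\<in>G. l g *\<^sub>R g) \<in> K" if "\<And>g. 0 \<le> l g" for l
    using that by (auto simp: K_def)
  have "convex_cone hull G \<subseteq> K"
  proof (rule hull_minimal)
    show "G \<subseteq> K"
    proof
      fix g assume g: "g \<in> G"
      have "(\<Sum>h\<in>G. (if h = g then 1 else 0) *\<^sub>R h) = (\<Sum>h\<in>G. if h = g then h else 0)"
        by (rule sum.cong) auto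
      also have "\<dots> = g" using assms(1) g by simp
      finally show "g \<in> K" using KI[of "\<lambda>h. if h = g then 1 else 0"] by simp
    qed
    show "convex_cone K"
      unfolding convex_cone_iff
    proof (intro conjI ballI allI impI)
      show "0 \<in> K" using KI[of "\<lambda>_. 0"] by simp
      show "x + y \<in> K" if x: "x \<in> K" and y: "y \<in> K" for x y
      proof -
        obtain l where "\<And>g. 0 \<le> l g" "x = (\<Sum>g\<in>G. l g *\<^sub>R g)" using x unfolding K_def by blast
        moreover obtain m where "\<And>g. 0 \<le> m g" "y = (\<Sum>g\<in>G. m g *\<^sub>R g)" using y unfolding K_def by blast
        ultimately show ?thesis using KI[of "\<lambda>g. l g + m g"] by (simp add: scaleR_add_left sum.distrib)
      qed
      show "c *\<^sub>R x \<in> K" if x: "x \<in> K" and c: "0 \<le> c" for x c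
      proof -
        obtain l where "\<And>g. 0 \<le> l g" "x = (\<Sum>g\<in>G. l g *\<^sub>R g)" using x unfolding K_def by blast
        then show ?thesis using KI[of "\<lambda>g. c * l g"] c by (simp add: scaleR_sum_right)
      qed
    qed
  qed
  then show ?thesis using assms(2) unfolding K_def by blast
qed

text \<open>
A pigeonhole argument replaces linear programming over the rationals. Write \<open>N z\<close> as the combination with
coefficients \<open>\<lfloor>N l\<^sub>s\<rfloor>\<close> plus a remainder. The remainders are vectors of natural numbers bounded
independently of \<open>N\<close>, so two multiples \<open>M < N\<close> have the same one, and the difference of their combinations
represents \<open>(N - M) z\<close>; its coefficients are natural numbers because \<open>\<lfloor>N l\<^sub>s\<rfloor>\<close> increases with \<open>N\<close>.
\<close>

lemma natural_multiple_of_nonneg_combination: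
  fixes w :: "'s \<Rightarrow> 'j \<Rightarrow> nat" and z :: "'j \<Rightarrow> nat" and l :: "'s \<Rightarrow> real"
  assumes J: "finite J" and l: "\<And>s. 0 \<le> l s"
    and z: "\<And>j. j \<in> J \<Longrightarrow> real (z j) = (\<Sum>s\<in>S. l s * real (w s j))"
  shows "\<exists>N\<ge>1. \<exists>m :: 's \<Rightarrow> nat. \<forall>j\<in>J. N * z j = (\<Sum>s\<in>S. m s * w s j)"
proof -
  define fl where "fl N s = nat \<lfloor>real N * l s\<rfloor>" for N s
  have fl: "real (fl N s) \<le> real N * l s" "real N * l s \<le> real (fl N s) + 1" for N s
    using l[of s] by (auto simp: fl_def)
  have mono: "fl M s \<le> fl N s" if "M \<le> N" for M N s
    using that l[of s] unfolding fl_def by (intro nat_mono floor_mono mult_right_mono) auto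
  have Nz: "real (N * z j) = (\<Sum>s\<in>S. real N * l s * real (w s j))" if "j \<in> J" for N j
    by (simp add: z[OF that] sum_distrib_left mult.assoc)
  have lower: "(\<Sum>s\<in>S. fl N s * w s j) \<le> N * z j" if "j \<in> J" for N j
  proof -
    have "real (\<Sum>s\<in>S. fl N s * w s j) \<le> real (N * z j)"
      unfolding Nz[OF that] using fl(1) by (simp add: sum_mono mult_right_mono)
    then show ?thesis by linarith
  qed
  have upper: "N * z j \<le> (\<Sum>s\<in>S. fl N s * w s j) + (\<Sum>s\<in>S. w s j)" if "j \<in> J" for N j
  proof -
    have "real (N * z j) \<le> (\<Sum>s\<in>S. (real (fl N s) + 1) * real (w s j))"
      unfolding Nz[OF that] using fl(2) by (intro sum_mono mult_right_mono) auto
    also have "\<dots> = real ((\<Sum>s\<in>S. fl N s * w s j) + (\<Sum>s\<in>S. w s j))"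
      by (simp add: algebra_simps sum.distrib)
    finally show ?thesis by linarith
  qed
  define r where "r N = (\<lambda>j\<in>J. N * z j - (\<Sum>s\<in>S. fl N s * w s j))" for N
  have "range r \<subseteq> (\<Pi>\<^sub>E j\<in>J. {..\<Sum>s\<in>S. w s j})"
  proof -
    have "N * z j - (\<Sum>s\<in>S. fl N s * w s j) \<le> (\<Sum>s\<in>S. w s j)" if "j \<in> J" for N j
      using upper[OF that, of N] by linarith
    then show ?thesis by (auto simp: r_def PiE_iff)
  qed
  moreover have "finite (\<Pi>\<^sub>E j\<in>J. {..\<Sum>s\<in>S. w s j})" using J by (intro finite_PiE) auto
  ultimately have "finite (range r)" by (rule finite_subset)
  then have "\<not> inj r" using finite_imageD infinite_UNIV_nat by blast
  then obtain M N where MN: "M < N" "r M = r N"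
    unfolding inj_def by (metis linorder_neqE_nat)
  have "(N - M) * z j = (\<Sum>s\<in>S. (fl N s - fl M s) * w s j)" if j: "j \<in> J" for j
  proof -
    have "M * z j - (\<Sum>s\<in>S. fl M s * w s j) = N * z j - (\<Sum>s\<in>S. fl N s * w s j)"
      using fun_cong[OF MN(2), of j] j by (simp add: r_def)
    then have "N * z j - M * z j = (\<Sum>s\<in>S. fl N s * w s j) - (\<Sum>s\<in>S. fl M s * w s j)"
      using lower[OF j, of M] lower[OF j, of N] by linarith
    also have "\<dots> = (\<Sum>s\<in>S. fl N s * w s j - fl M s * w s j)"
      using mono[of M N] MN(1) by (intro sum_subtractf_nat[symmetric]) simp
    finally show ?thesis by (simp add: diff_mult_distrib)
  qed
  then show ?thesis using MN(1) by (intro exI[of _ "N - M"]) auto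
qed

text \<open>
In terms of monomials: if \<open>(a, k)\<close> lies in the cone of \<open>J\<close>, then some power \<open>(x\<^sup>a)\<^sup>N\<close> lies in \<open>J\<^sup>k\<^sup>N\<close>.
\<close>

lemma multiple_of_rees_cone_point:
  fixes E :: "('n::{finite,linorder} \<Rightarrow>\<^sub>0 nat) set"
  assumes E: "upward_closed E" and a: "(exponent_vec a, real k) \<in> exponent_cone E"
  shows "\<exists>N\<ge>1. \<exists>b \<in> exponents_power E (k * N). \<forall>i. Poly_Mapping.lookup b i = N * Poly_Mapping.lookup a i"
proof -
  define G where "G = cone_generators E"
  have finG: "finite G" unfolding G_def by (rule finite_cone_generators)
  obtain l where l: "\<And>g. 0 \<le> l g" "(exponent_vec a, real k) = (\<Sum>g\<in>G. l g *\<^sub>R g)"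
    using convex_cone_hull_finite_sum[OF finG] a unfolding exponent_cone_def G_def by blast
  \<comment> \<open>an additive set of lattice points that contains the generators of the cone\<close>
  define T where "T = {(exponent_vec b, real j) | b j. b \<in> exponents_power E j}"
  have T0: "0 \<in> T"
    unfolding T_def by (auto simp: zero_prod_def exponent_vec_def vec_eq_iff intro!: exI[of _ 0])
  have T_add: "p + q \<in> T" if p: "p \<in> T" and q: "q \<in> T" for p q
  proof -
    obtain b i where "p = (exponent_vec b, real i)" "b \<in> exponents_power E i"
      using p unfolding T_def by blast
    moreover obtain c j where "q = (exponent_vec c, real j)" "c \<in> exponents_power E j"
      using q unfolding T_def by blast
    ultimately have "p + q = (exponent_vec (b + c), real (i + j)) \<and> b + c \<in> exponents_power E (i + j)"
      using add_mem_exponents_power by (simp add: exponent_vec_add)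
    then show ?thesis unfolding T_def by blast
  qed
  have GT: "g \<in> T" if g: "g \<in> G" for g
  proof (cases "g \<in> range (\<lambda>i. (axis i 1, 0))")
    case True
    then obtain i where "g = (axis i 1, 0)" by blast
    then have "g = (exponent_vec (Poly_Mapping.single i 1), real 0)"
      by (simp add: exponent_vec_def axis_def lookup_single when_def vec_eq_iff)
    then show ?thesis unfolding T_def by force
  next
    case False
    then obtain v where v: "v \<in> E" "g = (exponent_vec v, real 1)"
      using g by (auto simp: G_def cone_generators_def minimal_exponents_def)
    have "v = v + 0 \<and> v \<in> E \<and> 0 \<in> exponents_power E 0" using v(1) by simp
    then have "v \<in> exponents_power E (Suc 0)" unfolding exponents_power.simps by blast
    then show ?thesis using v(2) unfolding T_def One_nat_def by blast
  qed
  have T_mult: "real m *\<^sub>R g \<in> T" if "g \<in> T" for m g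
    by (induction m) (auto simp: T0 scaleR_add_left intro: T_add that)
  have T_sum: "(\<Sum>g\<in>H. real (m g) *\<^sub>R g) \<in> T" if "H \<subseteq> G" for m :: "_ \<Rightarrow> nat" and H
    using that by (induction H rule: infinite_finite_induct) (auto simp: T0 intro: T_add T_mult GT)
  \<comment> \<open>coordinates of the generators, the last one indexed by \<open>None\<close>\<close>
  define w :: "(real, 'n) vec \<times> real \<Rightarrow> 'n option \<Rightarrow> nat"
    where "w g j = (case j of None \<Rightarrow> nat \<lfloor>snd g\<rfloor> | Some i \<Rightarrow> nat \<lfloor>fst g $ i\<rfloor>)" for g j
  define z :: "'n option \<Rightarrow> nat"
    where "z j = (case j of None \<Rightarrow> k | Some i \<Rightarrow> Poly_Mapping.lookup a i)" for j
  have w: "real (w g None) = snd g" "real (w g (Some i)) = fst g $ i" if "g \<in> G" for g i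
    using GT[OF that] by (auto simp: w_def T_def exponent_vec_def)
  have "real (z j) = (\<Sum>g\<in>G. l g * real (w g j))" for j
  proof (cases j)
    case None
    have "snd (exponent_vec a, real k) = (\<Sum>g\<in>G. l g * snd g)" unfolding l(2) by (simp add: snd_sum)
    also have "\<dots> = (\<Sum>g\<in>G. l g * real (w g None))" by (rule sum.cong) (simp_all add: w)
    finally show ?thesis by (simp add: z_def None)
  next
    case (Some i)
    have "fst (exponent_vec a, real k) $ i = (\<Sum>g\<in>G. l g * (fst g $ i))" unfolding l(2) by (simp add: fst_sum)
    also have "\<dots> = (\<Sum>g\<in>G. l g * real (w g (Some i)))" by (rule sum.cong) (simp_all add: w)
    finally show ?thesis by (simp add: z_def Some exponent_vec_def)
  qed
  then obtain N m where N: "N \<ge> 1" "\<And>j. N * z j = (\<Sum>g\<in>G. m g * w g j)"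
    using natural_multiple_of_nonneg_combination[where J = UNIV and l = l and z = z and S = G and w = w] l(1)
    by auto
  define p where "p = (\<Sum>g\<in>G. real (m g) *\<^sub>R g)"
  have p_snd: "snd p = real (N * k)"
  proof -
    have "snd p = (\<Sum>g\<in>G. real (m g) * real (w g None))" unfolding p_def snd_sum by (rule sum.cong) (simp_all add: w)
    also have "\<dots> = real (N * z None)" unfolding N(2) by simp
    finally show ?thesis by (simp add: z_def)
  qed
  have p_fst: "fst p $ i = real (N * Poly_Mapping.lookup a i)" for i
  proof -
    have "fst p $ i = (\<Sum>g\<in>G. real (m g) * real (w g (Some i)))"
      unfolding p_def fst_sum sum_component by (rule sum.cong) (simp_all add: w)
    also have "\<dots> = real (N * z (Some i))" unfolding N(2) by simp
    finally show ?thesis by (simp add: z_def)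
  qed
  have "p \<in> T" unfolding p_def by (rule T_sum) simp
  then obtain b j where b: "p = (exponent_vec b, real j)" "b \<in> exponents_power E j" unfolding T_def by blast
  have "j = k * N" using p_snd b(1) by (simp add: mult.commute flip: of_nat_mult)
  moreover have "Poly_Mapping.lookup b i = N * Poly_Mapping.lookup a i" for i
  proof -
    have "real (Poly_Mapping.lookup b i) = real (N * Poly_Mapping.lookup a i)"
      using p_fst[of i] b(1) by (simp add: exponent_vec_def)
    then show ?thesis by (simp only: of_nat_eq_iff)
  qed
  ultimately show ?thesis using N(1) b(2) by blast
qed

section \<open>Normality of Rees algebras\<close>

text \<open>
A witness is the monic polynomial \<open>X\<^sup>N - z\<^sup>N\<close>.
\<close>

lemma integral_over_if_power_mem:
  fixes A :: "'a::idom set"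
  assumes A: "0 \<in> A" "1 \<in> A" "\<And>x. x \<in> A \<Longrightarrow> - x \<in> A" and N: "N \<ge> 1" and z: "z ^ N \<in> fract_of ` A"
  shows "integral_over (fract_of ` A) z"
proof -
  from z obtain c where c: "z ^ N = fract_of c" "c \<in> A" by blast
  define p where "p = monom 1 N - [:fract_of c:]"
  have cf: "coeff p i = (if i = N then 1 else if i = 0 then - fract_of c else 0)" for i
    using N by (auto simp: p_def coeff_pCons split: nat.split)
  have "degree p = N"
  proof (rule antisym)
    show "degree p \<le> N" by (rule degree_le) (use N cf in auto)
    show "N \<le> degree p" by (rule le_degree) (simp add: cf)
  qed
  then have "lead_coeff p = 1" by (simp add: cf)
  moreover have "coeff p i \<in> fract_of ` A" for i
  proof -
    have "fract_of 1 \<in> fract_of ` A" "fract_of 0 \<in> fract_of ` A" "fract_of (- c) \<in> fract_of ` A"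
      using A c by blast+
    then show ?thesis by (simp add: cf One_fract_def Zero_fract_def)
  qed
  moreover have "poly p z = 0" by (simp add: p_def poly_monom c)
  ultimately show ?thesis unfolding integral_over_def by blast
qed

text \<open>
An intersection of subrings may have a smaller field of fractions, but its elements and its integral equations
remain available in every member.
\<close>

lemma normal_subring_Inter:
  fixes F :: "'a::idom set set"
  assumes "F \<noteq> {}" and "\<And>A. A \<in> F \<Longrightarrow> normal_subring A"
  shows "normal_subring (\<Inter>F)"
  unfolding normal_subring_def
proof (intro ballI impI)
  fix z :: "'a fract"
  assume z: "z \<in> fraction_field_of (\<Inter>F)" "integral_over (fract_of ` \<Inter>F) z"
  have *: "z \<in> fract_of ` A" if "A \<in> F" for A
  proof -
    have "z \<in> fraction_field_of A" using z(1) that unfolding fraction_field_of_def by blast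
    moreover have "integral_over (fract_of ` A) z" using z(2) that unfolding integral_over_def by blast
    ultimately show ?thesis using assms(2)[OF that] by (auto simp: normal_subring_def)
  qed
  obtain A where A: "A \<in> F" using assms(1) by blast
  obtain a where a: "z = fract_of a" using *[OF A] by blast
  have "a \<in> B" if "B \<in> F" for B
    using *[OF that] a by (auto simp: eq_fract)
  with a show "z \<in> fract_of ` \<Inter>F" by blast
qed

lemma fract_of_power: "fract_of (c :: 'a::idom) ^ N = fract_of (c ^ N)"
  by (induction N) (simp_all add: One_fract_def)

lemma monom_mem_rees_algebra: "monom c k \<in> rees_algebra J \<longleftrightarrow> c \<in> ideal_power J k"
  using ideal_zero[OF is_ideal_power] by (auto simp: rees_algebra_def)

text \<open>
For \<open>(a, k)\<close> in the cone, \<open>x\<^sup>at\<^sup>k\<close> is integral over the Rees algebra, since one of its powers lies in it. It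
belongs to the field of fractions because \<open>x\<^sup>at\<^sup>k = (x\<^sup>a\<^sup>+\<^sup>ut\<^sup>k) / x\<^sup>u\<close> for any exponent \<open>u\<close> of \<open>J\<^sup>k\<close>.
\<close>

lemma normal_rees_algebra_contains_lattice_points:
  fixes E :: "('n::{finite,linorder} \<Rightarrow>\<^sub>0 nat) set"
  assumes E: "upward_closed E" and normal: "normal_subring (rees_algebra (mono_ideal E :: ('n, 'k::field) mpoly set))"
    and a: "(exponent_vec a, real k) \<in> exponent_cone E"
  shows "a \<in> exponents_power E k"
proof (cases "k = 0")
  case False
  define A where "A = rees_algebra (mono_ideal E :: ('n, 'k) mpoly set)"
  have A: "monom (monom_of c) j \<in> A \<longleftrightarrow> c \<in> exponents_power E j" for c j
    unfolding A_def monom_mem_rees_algebra ideal_power_mono_ideal by simp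
  obtain N b where N: "N \<ge> 1" "b \<in> exponents_power E (k * N)"
    "\<And>i. Poly_Mapping.lookup b i = N * Poly_Mapping.lookup a i"
    using multiple_of_rees_cone_point[OF E a] by blast
  \<comment> \<open>the cone of the zero ideal has no points of positive height\<close>
  have "E \<noteq> {}"
  proof
    assume "E = {}"
    moreover obtain j where "k * N = Suc j" using False N(1) by (cases "k * N") auto
    ultimately show False using N(2) by simp
  qed
  then have "\<exists>u. u \<in> exponents_power E k" by (induction k) auto
  then obtain u where u: "u \<in> exponents_power E k" ..
  define z where "z = fract_of (monom (monom_of a :: ('n, 'k) mpoly) k)"
  have mon0: "(monom_of c :: ('n, 'k) mpoly) \<noteq> 0" for c
    by (metis monom_of_def keys_single keys_zero insert_not_empty zero_neq_one)
  have "z \<in> fraction_field_of A"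
  proof -
    have "z = Fract (monom (monom_of (a + u)) k) (monom (monom_of u) 0)"
      using mon0[of u] by (simp add: z_def eq_fract mult_monom monom_of_add)
    moreover have "monom (monom_of (a + u)) k \<in> A"
      using upward_closedD[OF upward_closed_power u, of a] by (simp add: A add.commute)
    moreover have "monom (monom_of u) 0 \<in> A" by (simp add: A)
    moreover have "monom (monom_of u :: ('n, 'k) mpoly) 0 \<noteq> 0" using mon0 by simp
    ultimately show ?thesis unfolding fraction_field_of_def by blast
  qed
  moreover have "integral_over (fract_of ` A) z"
  proof (rule integral_over_if_power_mem[OF _ _ _ N(1)])
    show "0 \<in> A" using monom_mem_rees_algebra[of 0 0] by (simp add: A_def)
    show "1 \<in> A" using monom_mem_rees_algebra[of 1 0] by (simp add: A_def)
    show "- x \<in> A" if "x \<in> A" for x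
      using that module.subspace_neg[OF module_mult is_ideal_power] by (auto simp: A_def rees_algebra_def)
    have "b = (\<Sum>i<N. a)" by (rule poly_mapping_eqI) (simp add: lookup_sum N(3))
    then have "(monom_of a :: ('n, 'k) mpoly) ^ N = monom_of b" by (simp only: monom_of_sum) simp
    then have "z ^ N = fract_of (monom (monom_of b) (k * N))"
      by (simp add: z_def fract_of_power monom_power)
    then show "z ^ N \<in> fract_of ` A" using A[of b "k * N"] N(2) by blast
  qed
  ultimately have "z \<in> fract_of ` A" using normal by (simp add: normal_subring_def A_def)
  then have "monom (monom_of a) k \<in> A" by (auto simp: z_def eq_fract)
  then show ?thesis by (simp add: A)
qed simp

section \<open>Comparison of cones by lattice points\<close>

text \<open>
Scale a point of the intersection to height \<open>1\<close> and round its coordinates up to multiples of \<open>1 / (n + 1)\<close>.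
Rounding up stays in every cone, the rounded point is a positive multiple of a lattice point and hence lies in
the target cone, and the limit \<open>n \<rightarrow> \<infinity>\<close> stays there because the cone is closed.
\<close>

lemma exponent_cone_lattice_criterion:
  fixes E :: "('n::{finite,linorder} \<Rightarrow>\<^sub>0 nat) set" and \<F> :: "('n \<Rightarrow>\<^sub>0 nat) set set"
  assumes lattice: "\<And>a k. (\<And>F. F \<in> \<F> \<Longrightarrow> (exponent_vec a, real k) \<in> exponent_cone F)
      \<Longrightarrow> (exponent_vec a, real k) \<in> exponent_cone E"
    and ne: "\<F> \<noteq> {}"
  shows "(\<Inter>F\<in>\<F>. exponent_cone F) \<subseteq> exponent_cone E"
proof
  fix p assume p: "p \<in> (\<Inter>F\<in>\<F>. exponent_cone F)"
  obtain x t where xt: "p = (x, t)" by (cases p)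
  have xtF: "(x, t) \<in> exponent_cone F" if "F \<in> \<F>" for F using p xt that by blast
  obtain F0 where F0: "F0 \<in> \<F>" using ne by blast
  have t: "0 \<le> t" and x: "\<And>i. 0 \<le> x $ i"
    using exponent_cone_nonneg[OF xtF[OF F0]] by auto
  show "p \<in> exponent_cone E"
  proof (cases "t = 0")
    case True
    \<comment> \<open>at height \<open>0\<close> every cone is the nonnegative orthant\<close>
    have "(0, 0) \<in> exponent_cone E"
      using convex_cone_contains_0[OF convex_cone_exponent_cone, of E] by (simp add: zero_prod_def)
    then show ?thesis unfolding xt True by (rule exponent_cone_upward) (simp add: x)
  next
    case False
    then have t: "0 < t" using t by simp
    define y where "y = (1 / t) *\<^sub>R x"
    have y0: "0 \<le> y $ i" for i using t x[of i] by (simp add: y_def)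
    have yF: "(y, 1) \<in> exponent_cone F" if "F \<in> \<F>" for F
      using convex_cone_scaleR[OF convex_cone_exponent_cone _ xtF[OF that], of "1 / t"] t
      by (simp add: y_def)
    define Y where "Y n = (\<chi> i. of_int \<lceil>real (Suc n) * y $ i\<rceil> / real (Suc n))" for n
    have Y_bounds: "y $ i \<le> Y n $ i" "Y n $ i \<le> y $ i + 1 / real (Suc n)" for n i
    proof -
      have "real (Suc n) * y $ i \<le> of_int \<lceil>real (Suc n) * y $ i\<rceil>" by linarith
      then show "y $ i \<le> Y n $ i" by (simp add: Y_def field_simps del: of_nat_Suc)
      have "of_int \<lceil>real (Suc n) * y $ i\<rceil> \<le> real (Suc n) * y $ i + 1" by linarith
      then show "Y n $ i \<le> y $ i + 1 / real (Suc n)" by (simp add: Y_def field_simps del: of_nat_Suc)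
    qed
    have YE: "(Y n, 1) \<in> exponent_cone E" for n
    proof -
      define a where "a = Abs_poly_mapping (\<lambda>i. nat \<lceil>real (Suc n) * y $ i\<rceil>)"
      have a: "exponent_vec a = real (Suc n) *\<^sub>R Y n"
        using y0 by (simp add: exponent_vec_def a_def Y_def vec_eq_iff del: of_nat_Suc)
      have "(exponent_vec a, real (Suc n)) \<in> exponent_cone F" if "F \<in> \<F>" for F
      proof -
        have "(Y n, 1) \<in> exponent_cone F" using yF[OF that] Y_bounds(1) by (rule exponent_cone_upward)
        then have "real (Suc n) *\<^sub>R (Y n, 1) \<in> exponent_cone F"
          by (intro convex_cone_scaleR[OF convex_cone_exponent_cone]) simp_all
        then show ?thesis by (simp add: a)
      qed
      then have "(exponent_vec a, real (Suc n)) \<in> exponent_cone E" by (rule lattice)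
      then have "(1 / real (Suc n)) *\<^sub>R (exponent_vec a, real (Suc n)) \<in> exponent_cone E"
        by (intro convex_cone_scaleR[OF convex_cone_exponent_cone]) simp_all
      then show ?thesis by (simp add: a del: of_nat_Suc)
    qed
    have "(\<lambda>n. Y n $ i) \<longlonglongrightarrow> y $ i" for i
    proof (rule tendsto_sandwich[OF _ _ tendsto_const])
      show "(\<lambda>n. y $ i + 1 / real (Suc n)) \<longlonglongrightarrow> y $ i"
        using tendsto_add[OF tendsto_const LIMSEQ_Suc[OF lim_1_over_n]] by simp
    qed (intro always_eventually allI Y_bounds)+
    then have "Y \<longlonglongrightarrow> y" by (rule vec_tendstoI)
    then have "(\<lambda>n. (Y n, 1 :: real)) \<longlonglongrightarrow> (y, 1)" by (intro tendsto_Pair tendsto_const)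
    then have "(y, 1) \<in> exponent_cone E"
      by (rule closed_sequentially[OF closed_exponent_cone YE])
    then have "t *\<^sub>R (y, 1) \<in> exponent_cone E"
      using t by (intro convex_cone_scaleR[OF convex_cone_exponent_cone]) simp_all
    then show ?thesis using t by (simp add: xt y_def)
  qed
qed

section \<open>Equality of ordinary and symbolic powers\<close>

theorem corollary3:
  fixes I :: "('n::{finite,linorder}, 'k::field) mpoly set"
    and C :: "('n, 'k) mpoly set set"
  assumes "monomial_ideal I"
    and "I \<noteq> UNIV"
    and "\<nexists>P. embedded_prime I P"
    and "minimal_primary_decomposition I C"
    and "\<And>Q. Q \<in> C \<Longrightarrow> normal_subring (rees_algebra Q)"
  shows "(\<forall>k\<ge>1. ideal_power I k = symbolic_power I k) \<longleftrightarrow>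
         simis_cone C = rees_cone I \<and> normal_subring (rees_algebra I)"
proof -
  obtain E where E: "upward_closed E" and I: "I = mono_ideal E"
    using monomial_ideal_imp_mono_ideal[OF assms(1)] by blast
  have C: "minimal_primary_decomposition (mono_ideal E) C" using assms(4) by (simp only: I)
  have IC: "I = \<Inter>C" using assms(4) by (simp add: minimal_primary_decomposition_def)
  have C_ne: "C \<noteq> {}" using IC assms(2) by auto
  have min: "minimal_prime (mono_ideal E) (radical_ideal Q)" if "Q \<in> C" for Q
    using primary_component_radical_associated[OF wf_ideals_mpoly C that] assms(3)
    unfolding I embedded_prime_def by blast
  have "\<exists>F. upward_closed F \<and> Q = mono_ideal F" if Q: "Q \<in> C" for Q
  proof -
    obtain c where "Q = {f. monom_of c * f \<in> mono_ideal E}" using component_eq_colon[OF C min Q] by blast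
    then have "Q = mono_ideal {a. c + a \<in> E}" by (simp add: colon_monom_of)
    moreover have "upward_closed {a. c + a \<in> E}"
      using upward_closedD[OF E] by (auto simp: upward_closed_def simp flip: add.assoc)
    ultimately show ?thesis by blast
  qed
  then obtain F where F: "\<And>Q. Q \<in> C \<Longrightarrow> upward_closed (F Q)" "\<And>Q. Q \<in> C \<Longrightarrow> Q = mono_ideal (F Q)"
    by metis
  have cone_I: "rees_cone I = exponent_cone E" unfolding I by (rule rees_cone_eq_exponent_cone[OF E])
  have cone_C: "simis_cone C = (\<Inter>Q\<in>C. exponent_cone (F Q))"
    unfolding simis_cone_def using rees_cone_eq_exponent_cone[OF F(1), where 'k = 'k] F(2) by (intro INF_cong) auto
  have sym: "symbolic_power I k = (\<Inter>Q\<in>C. ideal_power Q k)" for k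
    unfolding I by (rule symbolic_power_eq_Inter[OF E C min])
  have power_Q: "ideal_power Q k = mono_ideal (exponents_power (F Q) k)" if "Q \<in> C" for Q k
    using F(2)[OF that] ideal_power_mono_ideal[of "F Q" k, where 'k = 'k] by simp
  have power_I: "ideal_power I k = mono_ideal (exponents_power E k)" for k
    unfolding I by (rule ideal_power_mono_ideal)
  have sub: "ideal_power I k \<subseteq> symbolic_power I k" for k
    unfolding sym using IC by (intro INF_greatest ideal_power_mono) blast
  have EF: "E \<subseteq> F Q" if Q: "Q \<in> C" for Q
  proof -
    have "(mono_ideal E :: ('n, 'k) mpoly set) \<subseteq> mono_ideal (F Q)"
      using IC Q F(2)[OF Q] unfolding I by blast
    then show ?thesis by (simp only: mono_ideal_subset_iff)
  qed
  have cone_sub: "rees_cone I \<subseteq> simis_cone C"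
    unfolding cone_I cone_C using exponent_cone_mono[OF F(1) EF] by blast
  show ?thesis
  proof
    assume eq: "\<forall>k\<ge>1. ideal_power I k = symbolic_power I k"
    \<comment> \<open>for \<open>k = 0\<close> both sides are the whole ring\<close>
    have eq': "ideal_power I k = (\<Inter>Q\<in>C. ideal_power Q k)" for k
    proof (cases "k = 0")
      case False
      then show ?thesis using eq sym[of k] by simp
    qed simp
    have "rees_algebra I = \<Inter>(rees_algebra ` C)"
      unfolding rees_algebra_def eq' by auto
    moreover have "normal_subring (\<Inter>(rees_algebra ` C))"
      using C_ne assms(5) by (intro normal_subring_Inter) auto
    ultimately have "normal_subring (rees_algebra I)" by simp
    moreover have "simis_cone C \<subseteq> rees_cone I"
    proof -
      have "(\<Inter>G\<in>F ` C. exponent_cone G) \<subseteq> exponent_cone E"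
      proof (rule exponent_cone_lattice_criterion)
        fix a k assume a: "\<And>G. G \<in> F ` C \<Longrightarrow> (exponent_vec a, real k) \<in> exponent_cone G"
        have "monom_of a \<in> ideal_power Q k" if Q: "Q \<in> C" for Q
        proof -
          have "normal_subring (rees_algebra (mono_ideal (F Q) :: ('n, 'k) mpoly set))"
            using assms(5)[OF Q] F(2)[OF Q] by simp
          then have "a \<in> exponents_power (F Q) k"
            using normal_rees_algebra_contains_lattice_points[OF F(1)[OF Q]] a Q by blast
          then show ?thesis by (simp add: power_Q[OF Q])
        qed
        then have "monom_of a \<in> ideal_power I k" unfolding eq' by blast
        then have "a \<in> exponents_power E k" by (simp add: power_I)
        then show "(exponent_vec a, real k) \<in> exponent_cone E" by (rule power_mem_exponent_cone[OF E])
      qed (use C_ne in auto)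
      then show ?thesis unfolding cone_I cone_C by simp
    qed
    ultimately show "simis_cone C = rees_cone I \<and> normal_subring (rees_algebra I)"
      using cone_sub by blast
  next
    assume asm: "simis_cone C = rees_cone I \<and> normal_subring (rees_algebra I)"
    have "symbolic_power I k \<subseteq> ideal_power I k" for k
    proof
      fix f assume f: "f \<in> symbolic_power I k"
      have "a \<in> exponents_power E k" if a: "a \<in> Poly_Mapping.keys f" for a
      proof -
        have "(exponent_vec a, real k) \<in> exponent_cone (F Q)" if Q: "Q \<in> C" for Q
        proof (rule power_mem_exponent_cone[OF F(1)[OF Q]])
          have "f \<in> ideal_power Q k" using f Q by (simp add: sym)
          then show "a \<in> exponents_power (F Q) k" using a by (auto simp: power_Q[OF Q] mono_ideal_def)
        qed
        then have "(exponent_vec a, real k) \<in> exponent_cone E" using asm cone_I cone_C by blast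
        then show ?thesis
          using normal_rees_algebra_contains_lattice_points[OF E] asm unfolding I by blast
      qed
      then show "f \<in> ideal_power I k" by (auto simp: power_I mono_ideal_def)
    qed
    then show "\<forall>k\<ge>1. ideal_power I k = symbolic_power I k" using sub by blast
  qed
qed

end
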